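(* Let $1\le p<2$ and let $\{X_n,n\ge1\}$ be a sequence of random variables satisfying the variance condition (V). Let $L$ be a slowly varying function on $[0,\infty)$ satisfying the standing assumptions (S); when $p=1$ assume further that $L(x)\ge1$ and $L$ is increasing on $[0,\infty)$. If $\{X_n,n\ge1\}$ is stochastically dominated by a random variable $X$ and $\mathbb{E}\left(|X|^pL^p(|X|)\right)<\infty$, then for all $\alpha\ge1/p$, $$\sum_{n=1}^{\infty} n^{\alpha p-2}\,\mathbb{P}\left(\max_{1\le j\le n}\left|\sum_{i=1}^{j}(X_i-\mathbb{E}(X_i))\right|>\varepsilon n^{\alpha}\tilde{L}(n^{\alpha})\right)<\infty\quad\text{for all }\varepsilon>0.$$
   Context: A family $\{X_i,i\in I\}$ is stochastically dominated by a random variable $X$ if $\sup_{i\in I}\mathbb{P}(|X_i|>t)\le\mathbb{P}(|X|>t)$ for all $t\ge0$. A function $R$ is slowly varying if it is positive and measurable on $[A,\infty)$ for some $A>0$ and $\lim_{x\to\infty}R(\lambda x)/R(x)=1$ for each $\lambda>0$. The de Bruijn conjugate $\tilde L$ of a slowly varying $L$ is a slowly varying function with $\lim_{x\to\infty}L(x)\tilde L(xL(x))=1$ and $\lim_{x\to\infty}\tilde L(x)L(x\tilde L(x))=1$. Standing assumptions (S): $L$ and $\tilde L$ are continuous on $[0,\infty)$ and differentiable on $[A,\infty)$ for some $A>0$, and $\lim_{x\to\infty}xL'(x)/L(x)=0$. Variance condition (V): there is a constant $C$ such that for all integers $k\ge0$, $\ell\ge1$ and all nondecreasing functions $f_i:\mathbb{R}\to\mathbb{R}$,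 $\operatorname{Var}\left(\sum_{i=k+1}^{k+\ell}f_i(X_i)\right)\le C\sum_{i=k+1}^{k+\ell}\operatorname{Var}(f_i(X_i))$, provided the variances exist. *)

theory Defs
  imports "HOL-Probability.Probability"
begin

definition slowly_varying :: "(real \<Rightarrow> real) \<Rightarrow> bool" where
  "slowly_varying R \<longleftrightarrow>
     (\<exists>A>0. (\<forall>x\<ge>A. R x > 0) \<and> R \<in> borel_measurable (restrict_space borel {A..}) \<and>
       (\<forall>c>0. ((\<lambda>x. R (c * x) / R x) \<longlongrightarrow> 1) at_top))"

definition de_bruijn_conjugate :: "(real \<Rightarrow> real) \<Rightarrow> (real \<Rightarrow> real) \<Rightarrow> bool" where
  "de_bruijn_conjugate L Lt \<longleftrightarrow>
     slowly_varying Lt \<and>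
     ((\<lambda>x. L x * Lt (x * L x)) \<longlongrightarrow> 1) at_top \<and>
     ((\<lambda>x. Lt x * L (x * Lt x)) \<longlongrightarrow> 1) at_top"

definition standing_assumptions :: "(real \<Rightarrow> real) \<Rightarrow> (real \<Rightarrow> real) \<Rightarrow> bool" where
  "standing_assumptions L Lt \<longleftrightarrow>
     continuous_on {0..} L \<and> continuous_on {0..} Lt \<and>
     (\<exists>A>0. \<forall>x\<ge>A. L differentiable (at x) \<and> Lt differentiable (at x)) \<and>
     ((\<lambda>x. x * deriv L x / L x) \<longlongrightarrow> 0) at_top"

definition (in prob_space) stoch_dominated :: "(nat \<Rightarrow> 'a \<Rightarrow> real) \<Rightarrow> ('a \<Rightarrow> real) \<Rightarrow> bool" where
  "stoch_dominated X Y \<longleftrightarrow>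
     (\<forall>t\<ge>0. (SUP i\<in>{1..}. prob {\<omega>\<in>space M. \<bar>X i \<omega>\<bar> > t}) \<le> prob {\<omega>\<in>space M. \<bar>Y \<omega>\<bar> > t})"

definition (in prob_space) variance_condition :: "(nat \<Rightarrow> 'a \<Rightarrow> real) \<Rightarrow> bool" where
  "variance_condition X \<longleftrightarrow>
     (\<exists>C::real. \<forall>(k::nat) (l::nat) (f::nat \<Rightarrow> real \<Rightarrow> real). l \<ge> 1 \<longrightarrow>
        (\<forall>i\<in>{k+1..k+l}. mono (f i)) \<longrightarrow>
        (\<forall>i\<in>{k+1..k+l}. integrable M (\<lambda>\<omega>. (f i (X i \<omega>))\<^sup>2)) \<longrightarrow>
        variance (\<lambda>\<omega>. \<Sum>i\<in>{k+1..k+l}. f i (X i \<omega>))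
          \<le> C * (\<Sum>i\<in>{k+1..k+l}. variance (\<lambda>\<omega>. f i (X i \<omega>))))"

end

theory Submission
  imports Defs
begin

text \<open>
  Since (V) is inherited by the positive and negative parts, one may assume that the variables are
  nonnegative. Put b k = 2^(k \<alpha>) Lt (2^(k \<alpha>)). Because (V) gives no maximal inequality, the maximum
  over j \<le> 2^m is chained along the dyadic expansion of j (Rio): blocks of length 2^k are
  truncated at the level b (k + 1) that fits their length, so that the loss caused by the
  many short blocks is compensated by the smaller truncated second moments, while the error of
  lowering the truncation from b (k + 1) to b k is again a monotone function of the variables. All
  second moments and biases are controlled by the tails P(|Y| > b l) alone, which is why
  stochastic domination suffices. These tails are summable against 2^(\<alpha> p l) by the moment assumption,
  because y L y is asymptotically inverse to x Lt x.
\<close>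

subsection \<open>Regularly varying normalization\<close>

text \<open>Everything is measured in powers of \<open>u\<close> = 2^(\<alpha> p):
  \<open>u ^ l\<close> weights the tail at level \<open>b l\<close>, and (u/2)^m is, up to a
  constant, the sum of n^(\<alpha> p - 2) over a dyadic block. Two comparisons decide the argument.
  Chebyshev's bound contains (b k)^(-2); since p < 2, there is \<rho> with u < \<rho>^2 such that b
  grows at least by the factor \<rho> per scale. Hence u^k / (b k)^2 decays geometrically, with room
  to distribute the deviation over the scales. The truncation bias of a block of length 2^k involves
  \<open>b l\<close> for all larger l and must be o(b k); this rests on 2^k b l \<le> K u^l b k. For
  p > 1 slow variation yields it because u > 2^\<alpha>; for p = 1 this slack vanishes, and L \<ge>
  1 increasing takes its place. A further obstacle is that Lt is not assumed monotone, while
  n^\<alpha> runs between the points at which b is sampled: monotonicity of y L y, a consequence of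
  the derivative condition, is transferred to x Lt x up to a constant \<kappa>.\<close>

lemma slowly_varying_eventually_pos:
  "slowly_varying R \<Longrightarrow> \<forall>\<^sub>F x in at_top. R x > 0"
  unfolding slowly_varying_def eventually_at_top_linorder by blast

lemma slowly_varying_tendsto:
  "slowly_varying R \<Longrightarrow> c > 0 \<Longrightarrow> ((\<lambda>x. R (c * x) / R x) \<longlongrightarrow> 1) at_top"
  unfolding slowly_varying_def by blast

text \<open>The derivative of z L z is L z (1 + z L' z / L z), and the quotient, tending to 0,
  eventually exceeds -1.\<close>

lemma eventually_mono_mult_slowly_varying:
  fixes L :: "real \<Rightarrow> real"
  assumes pos: "\<forall>\<^sub>F x in at_top. L x > 0"
    and diff: "\<forall>\<^sub>F x in at_top. L differentiable (at x)"
    and lim: "((\<lambda>x. x * deriv L x / L x) \<longlongrightarrow> 0) at_top"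
  shows "\<forall>\<^sub>F x in at_top. \<forall>y\<ge>x. x * L x \<le> y * L y"
proof -
  have "\<forall>\<^sub>F x in at_top. L x > 0 \<and> L differentiable (at x) \<and> x * deriv L x / L x > -1"
    using pos diff order_tendstoD(1)[OF lim, of "-1"] by (simp add: eventually_conj_iff)
  then obtain A where A: "\<And>x. x \<ge> A \<Longrightarrow> L x > 0" "\<And>x. x \<ge> A \<Longrightarrow> L differentiable (at x)"
      "\<And>x. x \<ge> A \<Longrightarrow> x * deriv L x / L x > -1"
    unfolding eventually_at_top_linorder by blast
  show ?thesis
    unfolding eventually_at_top_linorder
  proof (intro exI allI impI)
    fix x y assume "A \<le> x" "x \<le> y"
    show "x * L x \<le> y * L y"
    proof (rule DERIV_nonneg_imp_nondecreasing[OF \<open>x \<le> y\<close>])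
      fix z assume "x \<le> z" "z \<le> y"
      with \<open>A \<le> x\<close> have z: "z \<ge> A" by simp
      have "(L has_real_derivative deriv L z) (at z)"
        using A(2)[OF z] by (metis DERIV_imp_deriv real_differentiable_def)
      then have "((\<lambda>z. z * L z) has_real_derivative z * deriv L z + L z) (at z)"
        by (auto intro!: derivative_eq_intros)
      moreover have "0 \<le> z * deriv L z + L z"
        using A(1,3)[OF z] by (simp add: field_simps)
      ultimately show "\<exists>D. ((\<lambda>z. z * L z) has_real_derivative D) (at z) \<and> 0 \<le> D" by blast
    qed
  qed
qed

text \<open>If x Lt x stayed in [0, Z] for arbitrarily large x, compactness would bound L there,
  hence also x Lt x L (x Lt x), which is asymptotic to x.\<close>

lemma de_bruijn_filterlim:
  fixes L Lt :: "real \<Rightarrow> real"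
  assumes cont: "continuous_on {0..} L"
    and pos: "\<forall>\<^sub>F x in at_top. Lt x > 0"
    and lim: "((\<lambda>x. Lt x * L (x * Lt x)) \<longlongrightarrow> 1) at_top"
  shows "filterlim (\<lambda>x. x * Lt x) at_top at_top"
  unfolding filterlim_at_top
proof
  fix Z :: real
  define Z' where "Z' = max Z 0"
  have "compact (L ` {0..Z'})"
    using cont by (intro compact_continuous_image) (auto intro: continuous_on_subset)
  from compact_imp_bounded[OF this] obtain b where "\<forall>y\<in>L ` {0..Z'}. norm y \<le> b"
    unfolding bounded_iff by blast
  then have b: "\<bar>L y\<bar> \<le> b" if "0 \<le> y" "y \<le> Z'" for y
    using that by simp
  have "\<bar>L 0\<bar> \<le> b" by (rule b) (auto simp: Z'_def)
  then have "b \<ge> 0" by simp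
  have "\<forall>\<^sub>F x in at_top. Lt x * L (x * Lt x) > 1 / 2"
    using order_tendstoD(1)[OF lim, of "1/2"] by simp
  with pos eventually_gt_at_top[of "2 * Z' * b"] eventually_gt_at_top[of "0::real"]
  show "\<forall>\<^sub>F x in at_top. Z \<le> x * Lt x"
  proof eventually_elim
    case (elim x)
    show ?case
    proof (rule ccontr)
      assume "\<not> ?case"
      then have y: "0 \<le> x * Lt x" "x * Lt x \<le> Z'"
        using elim by (auto simp: Z'_def)
      have "x / 2 < x * (Lt x * L (x * Lt x))"
        using elim by simp
      also have "\<dots> = (x * Lt x) * L (x * Lt x)" by simp
      also have "\<dots> \<le> (x * Lt x) * b"
        using y b[OF y] by (intro mult_left_mono) auto
      also have "\<dots> \<le> Z' * b"
        using y \<open>b \<ge> 0\<close> by (intro mult_right_mono) auto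
      finally show False using elim by simp
    qed
  qed
qed

text \<open>A substitute for monotonicity of x Lt x. Put w = z Lt z. If x Lt x lay below \<kappa> w,
  monotonicity of y L y would bound x, up to constants, by \<kappa> w L (\<kappa> w); slow variation
  compares this with \<kappa> w L w, which is about \<kappa> z \<le> \<kappa> c x. For small
  \<kappa> this is absurd. Each limit is used at x or at z alone, so no uniform convergence theorem
  enters.\<close>

lemma de_bruijn_quasi_monotone:
  fixes L Lt :: "real \<Rightarrow> real"
  assumes L: "slowly_varying L"
    and mono: "\<forall>\<^sub>F x in at_top. \<forall>y\<ge>x. x * L x \<le> y * L y"
    and top: "filterlim (\<lambda>x. x * Lt x) at_top at_top"
    and lim: "((\<lambda>x. Lt x * L (x * Lt x)) \<longlongrightarrow> 1) at_top"
    and c: "c > 0"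
  shows "\<exists>\<kappa>>0. \<forall>\<^sub>F x in at_top. \<forall>z\<in>{x..c * x}. \<kappa> * (z * Lt z) \<le> x * Lt x"
proof (intro exI conjI)
  \<comment> \<open>The limits equal to 1 are replaced by the bounds 3/4 and 3/2. The contradiction
    needs 3/2 * 3/2 * \<kappa> c < 3/4, and \<kappa> c = 1/4 gives 9/16.\<close>
  define \<kappa> where "\<kappa> = 1 / (4 * c)"
  show \<kappa>: "1 / (4 * c) > 0" using c by simp
  have "((\<lambda>x. L (\<kappa> * (x * Lt x)) / L (x * Lt x)) \<longlongrightarrow> 1) at_top"
    using filterlim_compose[OF slowly_varying_tendsto[OF L, of \<kappa>] top] \<kappa> by (simp add: \<kappa>_def)
  then have "\<forall>\<^sub>F x in at_top. L (\<kappa> * (x * Lt x)) / L (x * Lt x) < 3 / 2"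
    by (rule order_tendstoD) simp
  moreover have "\<forall>\<^sub>F x in at_top. L (x * Lt x) > 0"
    using slowly_varying_eventually_pos[OF L] top unfolding filterlim_iff by blast
  moreover have "\<forall>\<^sub>F x in at_top. Lt x * L (x * Lt x) < 3 / 2"
    by (rule order_tendstoD(2)[OF lim]) simp
  moreover have "\<forall>\<^sub>F x in at_top. Lt x * L (x * Lt x) > 3 / 4"
    by (rule order_tendstoD(1)[OF lim]) simp
  moreover have "\<forall>\<^sub>F x in at_top. \<forall>y\<ge>x * Lt x. (x * Lt x) * L (x * Lt x) \<le> y * L y"
    using mono top unfolding filterlim_iff by blast
  moreover have "\<forall>\<^sub>F x in at_top. 0 \<le> x * Lt x"
    using top by (simp add: filterlim_at_top)
  ultimately have "\<forall>\<^sub>F x in at_top. L (\<kappa> * (x * Lt x)) / L (x * Lt x) < 3 / 2 \<and> L (x * Lt x) > 0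
      \<and> Lt x * L (x * Lt x) < 3 / 2 \<and> Lt x * L (x * Lt x) > 3 / 4
      \<and> (\<forall>y\<ge>x * Lt x. (x * Lt x) * L (x * Lt x) \<le> y * L y) \<and> 0 \<le> x * Lt x"
    by (simp add: eventually_conj_iff)
  then obtain A where A: "\<And>x. x \<ge> A \<Longrightarrow> L (\<kappa> * (x * Lt x)) / L (x * Lt x) < 3 / 2"
      "\<And>x. x \<ge> A \<Longrightarrow> L (x * Lt x) > 0"
      "\<And>x. x \<ge> A \<Longrightarrow> Lt x * L (x * Lt x) < 3 / 2" "\<And>x. x \<ge> A \<Longrightarrow> Lt x * L (x * Lt x) > 3 / 4"
      "\<And>x y. x \<ge> A \<Longrightarrow> y \<ge> x * Lt x \<Longrightarrow> (x * Lt x) * L (x * Lt x) \<le> y * L y"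
      "\<And>x. x \<ge> A \<Longrightarrow> 0 \<le> x * Lt x"
    unfolding eventually_at_top_linorder by blast
  show "\<forall>\<^sub>F x in at_top. \<forall>z\<in>{x..c * x}. 1 / (4 * c) * (z * Lt z) \<le> x * Lt x"
    using eventually_ge_at_top[of A] eventually_gt_at_top[of "0::real"] unfolding \<kappa>_def[symmetric]
  proof eventually_elim
    case (elim x)
    show ?case
    proof
      fix z assume z: "z \<in> {x..c * x}"
      then have zA: "z \<ge> A" using elim by simp
      define w where "w = z * Lt z"
      define y where "y = x * Lt x"
      have w0: "w \<ge> 0" and Lw: "L w > 0" using A(2,6)[OF zA] by (simp_all add: w_def)
      show "\<kappa> * (z * Lt z) \<le> x * Lt x"
      proof (rule ccontr)
        assume "\<not> ?thesis"
        then have "y \<le> \<kappa> * w" by (simp add: w_def y_def)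
        have "3 / 4 * x < x * (Lt x * L y)"
          using A(4)[OF elim(1)] elim by (simp add: y_def)
        also have "\<dots> = y * L y" by (simp add: y_def)
        also have "\<dots> \<le> (\<kappa> * w) * L (\<kappa> * w)"
          using A(5)[OF elim(1), of "\<kappa> * w"] \<open>y \<le> \<kappa> * w\<close> by (simp add: y_def)
        also have "\<dots> \<le> (\<kappa> * w) * (3 / 2 * L w)"
          using A(1)[OF zA] w0 Lw \<kappa> unfolding w_def[symmetric]
          by (intro mult_left_mono) (auto simp: \<kappa>_def field_simps)
        also have "\<dots> = 3 / 2 * \<kappa> * (z * (Lt z * L w))" by (simp add: w_def)
        also have "\<dots> \<le> 3 / 2 * \<kappa> * (c * x * (3 / 2))"
        proof (intro mult_left_mono)
          have "Lt z * L w \<le> 3 / 2" "3 / 4 < Lt z * L w" using A(3,4)[OF zA] by (simp_all add: w_def)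
          then show "z * (Lt z * L w) \<le> c * x * (3 / 2)"
            using z elim by (intro mult_mono) auto
        qed (use \<kappa> in \<open>simp add: \<kappa>_def\<close>)
        also have "\<dots> = 9 / 16 * x" using c by (simp add: \<kappa>_def)
        finally show False using elim by simp
      qed
    qed
  qed
qed

text \<open>This is what makes the truncation bias of a block of length 2^k negligible against the
  level at index k: after multiplication by a tail probability, the right-hand side becomes a term
  of the summable series of \<open>u ^ l * T l\<close>.\<close>

lemma de_bruijn_growth:
  fixes L Lt :: "real \<Rightarrow> real" and a u p :: real
  assumes Lt: "slowly_varying Lt"
    and top: "filterlim (\<lambda>x. x * Lt x) at_top at_top"
    and lim: "((\<lambda>x. Lt x * L (x * Lt x)) \<longlongrightarrow> 1) at_top"
    and "a > 1" and u: "u = a powr p" "u \<ge> 2" and "p \<ge> 1"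
    and p1: "p = 1 \<Longrightarrow> (\<forall>x\<ge>0. L x \<ge> 1) \<and> mono_on {0..} L"
  shows "\<exists>K. \<forall>\<^sub>F k in sequentially. \<forall>l\<ge>k. 2 ^ k * (a ^ l * Lt (a ^ l)) \<le> K * u ^ l * (a ^ k * Lt (a ^ k))"
proof -
  define B where "B k = a ^ k * Lt (a ^ k)" for k
  have xtop: "filterlim (\<lambda>k. a ^ k) at_top sequentially"
    using \<open>a > 1\<close> by (intro filterlim_at_infinity_imp_filterlim_at_top filterlim_realpow_sequentially_gt1) auto
  have Btop: "filterlim B at_top sequentially"
    unfolding B_def by (rule filterlim_compose[OF top xtop])
  have two_le: "2 ^ k \<le> u ^ k" for k
    using u by (intro power_mono) auto
  show ?thesis
    unfolding B_def[symmetric]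
  proof (cases "p = 1")
    case False
    then have "a powr 1 < a powr p"
      using \<open>p \<ge> 1\<close> \<open>a > 1\<close> by (intro powr_less_mono) auto
    then have "a < u" using \<open>a > 1\<close> u by simp
    then have "1 < u / a" using \<open>a > 1\<close> by simp
    have "((\<lambda>k. Lt (a * a ^ k) / Lt (a ^ k)) \<longlongrightarrow> 1) sequentially"
      using \<open>a > 1\<close> by (intro filterlim_compose[OF slowly_varying_tendsto[OF Lt] xtop]) auto
    from order_tendstoD(2)[OF this \<open>1 < u / a\<close>]
    have "\<forall>\<^sub>F k in sequentially. Lt (a * a ^ k) / Lt (a ^ k) < u / a" .
    moreover have "\<forall>\<^sub>F k in sequentially. Lt (a ^ k) > 0"
      using slowly_varying_eventually_pos[OF Lt] xtop unfolding filterlim_iff by blast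
    ultimately have "\<forall>\<^sub>F k in sequentially. B k > 0 \<and> B (Suc k) \<le> u * B k"
    proof eventually_elim
      case (elim k)
      then have "Lt (a * a ^ k) * a \<le> u * Lt (a ^ k)"
        using \<open>a > 1\<close> by (simp add: field_simps)
      then have "a ^ k * (Lt (a * a ^ k) * a) \<le> a ^ k * (u * Lt (a ^ k))"
        using \<open>a > 1\<close> by (intro mult_left_mono) auto
      then show ?case using elim \<open>a > 1\<close> by (simp add: B_def mult_ac)
    qed
    then obtain k0 where k0: "\<And>k. k \<ge> k0 \<Longrightarrow> B k > 0" "\<And>k. k \<ge> k0 \<Longrightarrow> B (Suc k) \<le> u * B k"
      unfolding eventually_sequentially by blast
    have "\<forall>l\<ge>k. 2 ^ k * B l \<le> 1 * u ^ l * B k" if "k \<ge> k0" for k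
    proof (intro allI impI)
      fix l assume "k \<le> l"
      then have "B l \<le> u ^ (l - k) * B k"
      proof (induction l rule: dec_induct)
        case (step l)
        have "B (Suc l) \<le> u * B l" using k0(2)[of l] step that by simp
        also have "\<dots> \<le> u * (u ^ (l - k) * B k)" using step u by (intro mult_left_mono) auto
        finally show ?case using step by (simp add: Suc_diff_le)
      qed simp
      then have "2 ^ k * B l \<le> u ^ k * (u ^ (l - k) * B k)"
        using two_le[of k] k0(1)[of l] that \<open>k \<le> l\<close> u by (intro mult_mono) auto
      also have "\<dots> = 1 * u ^ l * B k"
        using \<open>k \<le> l\<close> by (simp flip: power_add mult.assoc)
      finally show "2 ^ k * B l \<le> 1 * u ^ l * B k" .
    qed
    then show "\<exists>K. \<forall>\<^sub>F k in sequentially. \<forall>l\<ge>k. 2 ^ k * B l \<le> K * u ^ l * B k"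
      unfolding eventually_sequentially by blast
  next
    \<comment> \<open>Now u = a, and consecutive values of B may grow by more than u. Instead Lt
      (a^k) is comparable to 1 / L (B k), so that with L increasing Lt (a^l) \<le> 4 Lt (a^k)
      whenever B k \<le> B l; the 4 is the quotient of the bounds 2 and 1/2. If B l < B k, then 2^k
      \<le> u^l is enough.\<close>
    case True
    then have L: "\<And>x. x \<ge> 0 \<Longrightarrow> L x \<ge> 1" "mono_on {0..} L" and "u = a"
      using p1 u \<open>a > 1\<close> by auto
    have lim': "((\<lambda>k. Lt (a ^ k) * L (B k)) \<longlongrightarrow> 1) sequentially"
      using filterlim_compose[OF lim xtop] by (simp add: B_def)
    have "\<forall>\<^sub>F k in sequentially. 0 \<le> B k"
      using Btop by (simp add: filterlim_at_top)
    moreover have "\<forall>\<^sub>F k in sequentially. Lt (a ^ k) * L (B k) > 1 / 2"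
      by (rule order_tendstoD(1)[OF lim']) simp
    moreover have "\<forall>\<^sub>F k in sequentially. Lt (a ^ k) * L (B k) < 2"
      by (rule order_tendstoD(2)[OF lim']) simp
    ultimately have "\<forall>\<^sub>F k in sequentially. 0 \<le> B k \<and> Lt (a ^ k) * L (B k) > 1 / 2 \<and> Lt (a ^ k) * L (B k) < 2"
      by (simp add: eventually_conj_iff)
    then obtain k0 where k0: "\<And>k. k \<ge> k0 \<Longrightarrow> 0 \<le> B k" "\<And>k. k \<ge> k0 \<Longrightarrow> Lt (a ^ k) * L (B k) > 1 / 2"
        "\<And>k. k \<ge> k0 \<Longrightarrow> Lt (a ^ k) * L (B k) < 2"
      unfolding eventually_sequentially by blast
    have Lt_pos: "Lt (a ^ k) \<ge> 0" if "k \<ge> k0" for k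
      using k0(1)[OF that] zero_less_power[of a k] \<open>a > 1\<close> unfolding B_def zero_le_mult_iff by linarith
    have "2 ^ k * B l \<le> 4 * u ^ l * B k" if "k \<ge> k0" "l \<ge> k" for k l
    proof (cases "B k \<le> B l")
      case True
      have L0: "1 \<le> L (B k)" "1 \<le> L (B l)" "L (B k) \<le> L (B l)"
        using L True k0(1) that by (auto intro: mono_onD)
      have "Lt (a ^ l) * L (B k) \<le> Lt (a ^ l) * L (B l)"
        using L0 Lt_pos that by (intro mult_left_mono) auto
      also have "\<dots> \<le> 2" using k0(3)[of l] that by simp
      also have "\<dots> \<le> 4 * Lt (a ^ k) * L (B k)" using k0(2)[of k] that by linarith
      finally have "Lt (a ^ l) \<le> 4 * Lt (a ^ k)" using L0 by simp
      then have "2 ^ k * (u ^ l * Lt (a ^ l)) \<le> u ^ k * (u ^ l * (4 * Lt (a ^ k)))"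
        using two_le[of k] u Lt_pos that by (intro mult_mono mult_left_mono) auto
      then show ?thesis
        using \<open>u = a\<close> by (simp add: B_def mult_ac)
    next
      case False
      have "2 ^ k * B l \<le> u ^ l * B k"
      proof (rule mult_mono)
        show "2 ^ k \<le> u ^ l"
          using two_le[of k] power_increasing[OF that(2), of u] u by linarith
      qed (use False k0(1) that u in auto)
      also have "\<dots> \<le> 4 * u ^ l * B k"
        using k0(1)[OF that(1)] u by (simp add: mult_right_mono)
      finally show ?thesis .
    qed
    then show "\<exists>K. \<forall>\<^sub>F k in sequentially. \<forall>l\<ge>k. 2 ^ k * B l \<le> K * u ^ l * B k"
      unfolding eventually_sequentially by blast
  qed
qed

text \<open>Asymptotic information says nothing about the first terms of B. They are replaced by an
  exact geometric progression of ratio \<rho> running backwards from index k0, so that positivity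
  and both ratio bounds hold from index 0 on.\<close>

lemma geometric_extension:
  fixes B :: "nat \<Rightarrow> real"
  assumes "B k0 > 0" "0 < \<rho>" "\<rho> \<le> R"
    and B: "\<And>k. k \<ge> k0 \<Longrightarrow> \<rho> * B k \<le> B (Suc k)" "\<And>k. k \<ge> k0 \<Longrightarrow> B (Suc k) \<le> R * B k"
  obtains b where "\<And>k. k \<ge> k0 \<Longrightarrow> b k = B k" "\<And>k. b k > 0"
    "\<And>k. \<rho> * b k \<le> b (Suc k)" "\<And>k. b (Suc k) \<le> R * b k"
proof
  define b where "b k = (if k \<ge> k0 then B k else B k0 / \<rho> ^ (k0 - k))" for k
  have step: "b (Suc k) = \<rho> * b k" if "k < k0" for k
  proof -
    have "k0 - k = Suc (k0 - Suc k)" using that by simp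
    moreover have "b (Suc k) = B k0 / \<rho> ^ (k0 - Suc k)"
      using that by (cases "Suc k = k0") (auto simp: b_def)
    ultimately show ?thesis using that \<open>0 < \<rho>\<close> by (simp add: b_def)
  qed
  have B_pos: "B k > 0" if "k \<ge> k0" for k
    using that
  proof (induction k rule: nat_induct_at_least)
    case (Suc k)
    then have "0 < \<rho> * B k" using \<open>0 < \<rho>\<close> by simp
    with B(1)[of k] Suc.hyps show ?case by simp
  qed (rule \<open>B k0 > 0\<close>)
  show b_pos: "b k > 0" for k
    using B_pos[of k] assms(1,2) by (simp add: b_def)
  show "b k = B k" if "k \<ge> k0" for k using that by (simp add: b_def)
  show "\<rho> * b k \<le> b (Suc k)" for k
    using step[of k] B(1)[of k] by (cases "k < k0") (auto simp: b_def)
  show "b (Suc k) \<le> R * b k" for k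
  proof (cases "k < k0")
    case True
    then show ?thesis
      using step[OF True] mult_right_mono[OF \<open>\<rho> \<le> R\<close> less_imp_le[OF b_pos[of k]]] by simp
  qed (use B(2)[of k] in \<open>simp add: b_def\<close>)
qed

subsection \<open>Sums along dyadic scales\<close>

text \<open>As u \<ge> 2, the powers below the largest admissible one add up to at most that
  one.\<close>

lemma sum_powers_below:
  fixes u z :: real
  assumes "u \<ge> 2" "z \<ge> 0"
  shows "(\<Sum>l<N. if u ^ l \<le> z then u ^ l else 0) \<le> 2 * z"
proof (induction N)
  case 0
  show ?case using assms by simp
next
  case (Suc N)
  have geo: "(\<Sum>l<n. u ^ l) \<le> u ^ n" for n
  proof (induction n)
    case (Suc n)
    have "2 * u ^ n \<le> u * u ^ n" using assms by (intro mult_right_mono) auto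
    with Suc show ?case by simp
  qed simp
  show ?case
  proof (cases "u ^ N \<le> z")
    case True
    have "(\<Sum>l<N. if u ^ l \<le> z then u ^ l else 0) \<le> (\<Sum>l<N. u ^ l)"
      using assms by (intro sum_mono) auto
    with geo[of N] True show ?thesis by simp
  next
    case False
    with Suc show ?thesis by simp
  qed
qed

lemma summable_dyadic_blocks:
  fixes a :: "nat \<Rightarrow> real"
  assumes nonneg: "\<And>n. a n \<ge> 0" and sum: "summable (\<lambda>m. \<Sum>n\<in>{2^m..<2^Suc m}. a n)"
  shows "summable (\<lambda>m. a (Suc m))"
proof (rule summableI_nonneg_bounded)
  fix N
  have blocks: "(\<Sum>n\<in>{1..<2^N}. a n) = (\<Sum>m<N. \<Sum>n\<in>{2^m..<2^Suc m}. a n)" for N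
  proof (induction N)
    case (Suc N)
    have "(\<Sum>n\<in>{1..<2^Suc N}. a n) = (\<Sum>n\<in>{1..<2^N}. a n) + (\<Sum>n\<in>{2^N..<2^Suc N}. a n)"
      by (rule sum.atLeastLessThan_concat[symmetric]) auto
    with Suc show ?case by simp
  qed simp
  have "(\<Sum>m<N. a (Suc m)) = (\<Sum>n\<in>{1..<Suc N}. a n)"
    by (simp add: sum.shift_bounds_Suc_ivl lessThan_atLeast0 del: sum.op_ivl_Suc)
  also have "\<dots> \<le> (\<Sum>n\<in>{1..<2^N}. a n)"
    using nonneg by (intro sum_mono2) (auto simp: Suc_le_eq less_exp intro: le_less_trans)
  also have "\<dots> = (\<Sum>m<N. \<Sum>n\<in>{2^m..<2^Suc m}. a n)" by (rule blocks)
  also have "\<dots> \<le> (\<Sum>m. \<Sum>n\<in>{2^m..<2^Suc m}. a n)"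
    using nonneg by (intro sum_le_suminf sum sum_nonneg) auto
  finally show "(\<Sum>m<N. a (Suc m)) \<le> (\<Sum>m. \<Sum>n\<in>{2^m..<2^Suc m}. a n)" .
qed (rule nonneg)

lemma sum_power_diff_le:
  fixes \<theta> :: real
  assumes "0 \<le> \<theta>" "\<theta> < 1"
  shows "(1 - \<theta>) * (\<Sum>k\<le>m. \<theta> ^ (m - k)) \<le> 1"
proof (induction m)
  case 0
  show ?case using assms by simp
next
  case (Suc m)
  have "(\<Sum>k\<le>Suc m. \<theta> ^ (Suc m - k)) = \<theta> * (\<Sum>k\<le>m. \<theta> ^ (m - k)) + 1"
    by (simp add: sum_distrib_left Suc_diff_le)
  then have "(1 - \<theta>) * (\<Sum>k\<le>Suc m. \<theta> ^ (Suc m - k)) = \<theta> * ((1 - \<theta>) * (\<Sum>k\<le>m. \<theta> ^ (m - k))) + (1 - \<theta>)"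
    by (simp add: algebra_simps)
  also have "\<dots> \<le> \<theta> * 1 + (1 - \<theta>)"
    using Suc assms by (intro add_mono mult_left_mono) auto
  finally show ?case by simp
qed

lemma sum_geometric_growth_le:
  fixes b :: "nat \<Rightarrow> real"
  assumes "\<rho> > 1" "\<And>k. b k \<ge> 0" "\<And>k. \<rho> * b k \<le> b (Suc k)"
  shows "(\<rho> - 1) * (\<Sum>k\<le>m. b k) \<le> \<rho> * b m"
proof (induction m)
  case 0
  show ?case using assms(2)[of 0] by (simp add: algebra_simps)
next
  case (Suc m)
  then show ?case using assms(3)[of m] by (simp add: algebra_simps)
qed

lemma summable_convolution_geometric:
  fixes a :: "nat \<Rightarrow> real"
  assumes "summable a" "\<And>k. a k \<ge> 0" "0 \<le> r" "r < 1"
  shows "summable (\<lambda>m. \<Sum>k\<le>m. a k * r ^ (m - k))"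
proof (rule summable_Cauchy_product)
  show "summable (\<lambda>k. norm (a k))"
    using assms by simp
  show "summable (\<lambda>k. norm (r ^ k))"
    using assms by (simp add: summable_geometric)
qed

text \<open>The deterministic part of the chaining. The sum runs over the remainder of j modulo 2^n.
  Passing to n + 1 adds at most one complete block of length 2^n, already taken with the weights W
  (n + 1), and changes the weights on the old remainder from W n to W (n + 1). At n = 0 the
  remainder is empty.\<close>

lemma dyadic_remainder_bound:
  fixes W U :: "nat \<Rightarrow> nat \<Rightarrow> real" and A V :: "nat \<Rightarrow> real"
  assumes block: "\<And>k v. k < n \<Longrightarrow> v \<le> j div 2^k \<Longrightarrow> \<bar>\<Sum>i\<in>{v * 2^k + 1..v * 2^k + 2^k}. W (Suc k) i\<bar> \<le> A k"
    and change: "\<And>k i. k < n \<Longrightarrow> i \<ge> 1 \<Longrightarrow> \<bar>W (Suc k) i - W k i\<bar> \<le> U k i"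
    and block_change: "\<And>k v. k < n \<Longrightarrow> v \<le> j div 2^k \<Longrightarrow> (\<Sum>i\<in>{v * 2^k + 1..v * 2^k + 2^k}. U k i) \<le> V k"
  shows "\<bar>\<Sum>i\<in>{j div 2^n * 2^n + 1..j}. W n i\<bar> \<le> (\<Sum>k<n. A k + V k)"
  using assms
proof (induction n)
  case 0
  show ?case by simp
next
  case (Suc n)
  have IH: "\<bar>\<Sum>i\<in>{j div 2^n * 2^n + 1..j}. W n i\<bar> \<le> (\<Sum>k<n. A k + V k)"
    using Suc.prems by (intro Suc.IH) auto
  define v where "v = j div 2^n"
  define w where "w = j div 2^Suc n"
  have w: "w = v div 2"
    unfolding v_def w_def power_Suc2 by (rule div_mult2_eq)
  have vj: "v * 2^n \<le> j" "j < v * 2^n + 2^n"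
    unfolding v_def
    by (simp_all add: div_times_less_eq_dividend)
       (metis add.commute div_mult_mod_eq mod_less_divisor nat_add_left_cancel_less zero_less_numeral zero_less_power)
  have A0: "A n \<ge> 0"
    using Suc.prems(1)[of n v] by (simp add: v_def)
  have split: "(\<Sum>i\<in>{w * 2^Suc n + 1..j}. W (Suc n) i)
      = (\<Sum>i\<in>{w * 2^Suc n + 1..v * 2^n}. W (Suc n) i) + (\<Sum>i\<in>{v * 2^n + 1..j}. W (Suc n) i)"
  proof -
    have "2 * w \<le> v" using w by simp
    then have "2 * w * 2^n \<le> v * 2^n" by (rule mult_right_mono) simp
    then have le: "w * 2^Suc n \<le> v * 2^n" by (simp add: mult_ac)
    have "{a + 1..j} = {a + 1..b} \<union> {b + 1..j}" if "a \<le> b" "b \<le> j" for a b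
      using that by auto
    from this[OF le vj(1)]
    have "{w * 2^Suc n + 1..j} = {w * 2^Suc n + 1..v * 2^n} \<union> {v * 2^n + 1..j}" .
    then show ?thesis
      by (simp add: sum.union_disjoint)
  qed
  \<comment> \<open>The interval is governed by the binary digit of j at position n: it is empty if
    v is even and one complete block if v is odd.\<close>
  have 1: "\<bar>\<Sum>i\<in>{w * 2^Suc n + 1..v * 2^n}. W (Suc n) i\<bar> \<le> A n"
  proof (cases "even v")
    case True
    then have "v * 2^n = w * 2^Suc n" using w by auto
    then show ?thesis using A0 by simp
  next
    case False
    then have v: "v = 2 * w + 1" using w by presburger
    have "2 * w \<le> j div 2^n" using v v_def by simp
    from Suc.prems(1)[OF _ this] show ?thesis
      by (simp add: v algebra_simps)
  qed
  have 2: "\<bar>(\<Sum>i\<in>{v * 2^n + 1..j}. W (Suc n) i) - (\<Sum>i\<in>{v * 2^n + 1..j}. W n i)\<bar> \<le> V n"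
  proof -
    have U0: "U n i \<ge> 0" if "i \<ge> 1" for i
      using Suc.prems(2)[of n i] that by simp
    have "\<bar>(\<Sum>i\<in>{v * 2^n + 1..j}. W (Suc n) i) - (\<Sum>i\<in>{v * 2^n + 1..j}. W n i)\<bar>
        \<le> (\<Sum>i\<in>{v * 2^n + 1..j}. \<bar>W (Suc n) i - W n i\<bar>)"
      unfolding sum_subtractf[symmetric] by (rule sum_abs)
    also have "\<dots> \<le> (\<Sum>i\<in>{v * 2^n + 1..j}. U n i)"
      using Suc.prems(2) by (intro sum_mono) auto
    \<comment> \<open>Nonnegativity of U allows the remainder to be completed to a full block,
      possibly reaching beyond j. Hence only sums over complete blocks ever need a probability
      bound, and their number is small.\<close>
    also have "\<dots> \<le> (\<Sum>i\<in>{v * 2^n + 1..v * 2^n + 2^n}. U n i)"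
      using vj U0 by (intro sum_mono2) auto
    also have "\<dots> \<le> V n"
      using Suc.prems(3)[of n v] by (simp add: v_def)
    finally show ?thesis .
  qed
  show ?case
    using IH 1 2 split unfolding v_def[symmetric] w_def[symmetric] by simp
qed

subsection \<open>The dyadic maximal inequality\<close>

context prob_space
begin

text \<open>Chebyshev's inequality for the block sum, each variance being at most the second moment;
  boundedness of f settles all integrability.\<close>

lemma block_deviation:
  fixes Z :: "nat \<Rightarrow> 'a \<Rightarrow> real" and f :: "real \<Rightarrow> real"
  assumes Z [measurable]: "\<And>i. Z i \<in> borel_measurable M"
    and var: "variance (\<lambda>\<omega>. \<Sum>i\<in>{s+1..s+n}. f (Z i \<omega>)) \<le> C * (\<Sum>i\<in>{s+1..s+n}. variance (\<lambda>\<omega>. f (Z i \<omega>)))"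
    and f: "mono f" "\<And>x. \<bar>f x\<bar> \<le> B"
    and G: "\<And>i. i \<ge> 1 \<Longrightarrow> expectation (\<lambda>\<omega>. (f (Z i \<omega>))\<^sup>2) \<le> G"
    and "C \<ge> 0" "c > 0"
  shows "prob {\<omega>\<in>space M. \<bar>\<Sum>i\<in>{s+1..s+n}. f (Z i \<omega>) - expectation (\<lambda>\<omega>. f (Z i \<omega>))\<bar> \<ge> c} \<le> C * real n * G / c\<^sup>2"
proof -
  have [measurable]: "f \<in> borel_measurable borel"
    using f(1) by (rule borel_measurable_mono)
  have int: "integrable M (\<lambda>\<omega>. f (Z i \<omega>))" for i
    by (rule integrable_const_bound[of _ B]) (use f in auto)
  have "\<bar>f x\<bar>\<^sup>2 \<le> B\<^sup>2" for x
    using f(2)[of x] by (intro power_mono) auto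
  then have sq: "integrable M (\<lambda>\<omega>. (f (Z i \<omega>))\<^sup>2)" for i
    by (intro integrable_const_bound[of _ "B\<^sup>2"]) auto
  have "\<bar>\<Sum>i\<in>{s+1..s+n}. f (Z i \<omega>)\<bar> \<le> real n * B" for \<omega>
  proof -
    have "\<bar>\<Sum>i\<in>{s+1..s+n}. f (Z i \<omega>)\<bar> \<le> (\<Sum>i\<in>{s+1..s+n}. \<bar>f (Z i \<omega>)\<bar>)" by (rule sum_abs)
    also have "\<dots> \<le> (\<Sum>i\<in>{s+1..s+n}. B)" by (intro sum_mono f)
    finally show ?thesis by simp
  qed
  then have "(\<Sum>i\<in>{s+1..s+n}. f (Z i \<omega>))\<^sup>2 \<le> (real n * B)\<^sup>2" for \<omega>
    by (metis abs_ge_zero power2_abs power_mono)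
  then have sqS: "integrable M (\<lambda>\<omega>. (\<Sum>i\<in>{s+1..s+n}. f (Z i \<omega>))\<^sup>2)"
    by (intro integrable_const_bound[of _ "(real n * B)\<^sup>2"]) auto
  have "prob {\<omega>\<in>space M. \<bar>\<Sum>i\<in>{s+1..s+n}. f (Z i \<omega>) - expectation (\<lambda>\<omega>. f (Z i \<omega>))\<bar> \<ge> c}
     = prob {\<omega>\<in>space M. \<bar>(\<Sum>i\<in>{s+1..s+n}. f (Z i \<omega>)) - expectation (\<lambda>\<omega>. \<Sum>i\<in>{s+1..s+n}. f (Z i \<omega>))\<bar> \<ge> c}"
    by (simp add: Bochner_Integration.integral_sum int sum_subtractf)
  also have "\<dots> \<le> variance (\<lambda>\<omega>. \<Sum>i\<in>{s+1..s+n}. f (Z i \<omega>)) / c\<^sup>2"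
    using sqS \<open>c > 0\<close> by (intro Chebyshev_inequality) auto
  also have "\<dots> \<le> C * real n * G / c\<^sup>2"
  proof (rule divide_right_mono)
    have "variance (\<lambda>\<omega>. f (Z i \<omega>)) \<le> G" if "i \<ge> 1" for i
      using G[OF that] variance_eq[OF int sq, of i] by (smt (verit) zero_le_power2)
    then have "(\<Sum>i\<in>{s+1..s+n}. variance (\<lambda>\<omega>. f (Z i \<omega>))) \<le> (\<Sum>i\<in>{s+1..s+n}. G)"
      by (intro sum_mono) auto
    also have "\<dots> = real n * G" by simp
    finally have "C * (\<Sum>i\<in>{s+1..s+n}. variance (\<lambda>\<omega>. f (Z i \<omega>))) \<le> C * (real n * G)"
      by (rule mult_left_mono) fact
    with var show "variance (\<lambda>\<omega>. \<Sum>i\<in>{s+1..s+n}. f (Z i \<omega>)) \<le> C * real n * G"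
      by (simp add: mult.assoc)
  qed simp
  finally show ?thesis .
qed

section \<open>Truncated moments and truncation bias in terms of tails\<close>

lemma truncated_second_moment:
  fixes Z :: "'a \<Rightarrow> real" and b T :: "nat \<Rightarrow> real"
  assumes Z [measurable]: "Z \<in> borel_measurable M" and pos: "\<And>\<omega>. Z \<omega> \<ge> 0"
    and b: "mono b" "b 0 \<ge> 0"
    and tail: "\<And>l. prob {\<omega>\<in>space M. Z \<omega> > b l} \<le> T l"
  shows "expectation (\<lambda>\<omega>. (min (Z \<omega>) (b k))\<^sup>2) \<le> (b 0)\<^sup>2 + (\<Sum>l<k. (b (Suc l))\<^sup>2 * T l)"
proof (induction k)
  have b0: "b k \<ge> 0" for k
    using b monoD[OF b(1), of 0 k] by simp
  have "(min (Z \<omega>) (b k))\<^sup>2 \<le> (b k)\<^sup>2" for k \<omega>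
    using pos[of \<omega>] b0[of k] by (intro power_mono) auto
  then have int: "integrable M (\<lambda>\<omega>. (min (Z \<omega>) (b k))\<^sup>2)" for k
    by (intro integrable_const_bound[of _ "(b k)\<^sup>2"]) auto
  {
    case 0
    have "expectation (\<lambda>\<omega>. (min (Z \<omega>) (b 0))\<^sup>2) \<le> expectation (\<lambda>\<omega>. (b 0)\<^sup>2)"
      using pos b by (intro integral_mono int) (auto intro!: power_mono)
    then show ?case by (simp add: prob_space)
  next
    case (Suc k)
    \<comment> \<open>Raising the level from b k to b (k + 1) changes the square only where Z > b k,
      and there the new square is at most (b (k + 1))^2. So only the tails at the levels themselves
      enter.\<close>
    have "expectation (\<lambda>\<omega>. (min (Z \<omega>) (b (Suc k)))\<^sup>2)
       \<le> expectation (\<lambda>\<omega>. (min (Z \<omega>) (b k))\<^sup>2 + (b (Suc k))\<^sup>2 * indicator {\<omega>\<in>space M. Z \<omega> > b k} \<omega>)"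
    proof (intro integral_mono int Bochner_Integration.integrable_add)
      fix \<omega> assume "\<omega> \<in> space M"
      have "b k \<le> b (Suc k)" using b(1) by (simp add: monoD)
      moreover have "(min (Z \<omega>) (b (Suc k)))\<^sup>2 \<le> (b (Suc k))\<^sup>2"
        using pos[of \<omega>] b0[of "Suc k"] by (intro power_mono) auto
      ultimately show "(min (Z \<omega>) (b (Suc k)))\<^sup>2 \<le> (min (Z \<omega>) (b k))\<^sup>2 + (b (Suc k))\<^sup>2 * indicator {\<omega>\<in>space M. Z \<omega> > b k} \<omega>"
        using \<open>\<omega> \<in> space M\<close> by (cases "Z \<omega> > b k") (auto simp: min_def intro: add_increasing)
    qed (auto simp: emeasure_eq_measure)
    also have "\<dots> = expectation (\<lambda>\<omega>. (min (Z \<omega>) (b k))\<^sup>2) + (b (Suc k))\<^sup>2 * prob {\<omega>\<in>space M. Z \<omega> > b k}"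
      by (subst Bochner_Integration.integral_add) (auto intro!: int simp: emeasure_eq_measure)
    also have "\<dots> \<le> (b 0)\<^sup>2 + (\<Sum>l<Suc k. (b (Suc l))\<^sup>2 * T l)"
      using Suc.IH mult_left_mono[OF tail[of k], of "(b (Suc k))\<^sup>2"] by simp
    finally show ?case .
  }
qed

text \<open>The first-moment analogue: each raise of the level costs at most the new level times the
  tail at the old one. The starting level stays arbitrary because the limit n to infinity will give
  the bias at level k.\<close>

lemma truncated_expectation_increment:
  fixes Z :: "'a \<Rightarrow> real" and b T :: "nat \<Rightarrow> real"
  assumes Z [measurable]: "Z \<in> borel_measurable M" and pos: "\<And>\<omega>. Z \<omega> \<ge> 0"
    and b: "mono b" "b 0 \<ge> 0"
    and tail: "\<And>l. prob {\<omega>\<in>space M. Z \<omega> > b l} \<le> T l"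
  shows "expectation (\<lambda>\<omega>. min (Z \<omega>) (b (k + n))) \<le> expectation (\<lambda>\<omega>. min (Z \<omega>) (b k)) + (\<Sum>l<n. b (Suc (k + l)) * T (k + l))"
proof (induction n)
  have b0: "b k \<ge> 0" for k
    using b monoD[OF b(1), of 0 k] by simp
  have int: "integrable M (\<lambda>\<omega>. min (Z \<omega>) (b k))" for k
    using pos b0[of k] by (intro integrable_const_bound[of _ "b k"]) auto
  {
    case 0
    show ?case by simp
  next
    case (Suc n)
    define m where "m = k + n"
    have "expectation (\<lambda>\<omega>. min (Z \<omega>) (b (Suc m)))
       \<le> expectation (\<lambda>\<omega>. min (Z \<omega>) (b m) + b (Suc m) * indicator {\<omega>\<in>space M. Z \<omega> > b m} \<omega>)"
    proof (intro integral_mono int Bochner_Integration.integrable_add)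
      fix \<omega> assume "\<omega> \<in> space M"
      have "b m \<le> b (Suc m)" using b(1) by (simp add: monoD)
      then show "min (Z \<omega>) (b (Suc m)) \<le> min (Z \<omega>) (b m) + b (Suc m) * indicator {\<omega>\<in>space M. Z \<omega> > b m} \<omega>"
        using \<open>\<omega> \<in> space M\<close> b0[of m] by (cases "Z \<omega> > b m") auto
    qed (auto simp: emeasure_eq_measure)
    also have "\<dots> = expectation (\<lambda>\<omega>. min (Z \<omega>) (b m)) + b (Suc m) * prob {\<omega>\<in>space M. Z \<omega> > b m}"
      by (subst Bochner_Integration.integral_add) (auto intro!: int simp: emeasure_eq_measure)
    also have "\<dots> \<le> expectation (\<lambda>\<omega>. min (Z \<omega>) (b m)) + b (Suc m) * T m"
      using tail[of m] b0 by (simp add: mult_left_mono)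
    finally show ?case
      using Suc.IH by (simp add: m_def)
  }
qed

text \<open>The truncated expectations increase and are bounded by the increment estimate, so
  monotone convergence yields both integrability and the value of the expectation; the bias bound is
  the limit of the increment bounds.\<close>

lemma truncation_bias:
  fixes Z :: "'a \<Rightarrow> real" and b T :: "nat \<Rightarrow> real"
  assumes Z [measurable]: "Z \<in> borel_measurable M" and pos: "\<And>\<omega>. Z \<omega> \<ge> 0"
    and b: "mono b" "b 0 \<ge> 0" "filterlim b at_top sequentially"
    and tail: "\<And>l. prob {\<omega>\<in>space M. Z \<omega> > b l} \<le> T l"
    and sum: "summable (\<lambda>l. b (Suc l) * T l)"
  shows "integrable M Z"
    and "expectation Z - expectation (\<lambda>\<omega>. min (Z \<omega>) (b k)) \<le> (\<Sum>l. b (Suc (k + l)) * T (k + l))"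
proof -
  have b0: "b k \<ge> 0" for k
    using b monoD[OF b(1), of 0 k] by simp
  have T0: "T l \<ge> 0" for l
    using tail[of l] measure_nonneg order_trans by blast
  have int: "integrable M (\<lambda>\<omega>. min (Z \<omega>) (b k))" for k
    using pos b0[of k] by (intro integrable_const_bound[of _ "b k"]) auto
  define e where "e k = (\<Sum>l. b (Suc (k + l)) * T (k + l))" for k
  have sum': "summable (\<lambda>l. b (Suc (k + l)) * T (k + l))" for k
    using summable_ignore_initial_segment[OF sum, of k] by (simp add: add.commute)
  define E where "E n = expectation (\<lambda>\<omega>. min (Z \<omega>) (b n))" for n
  have upper: "E n \<le> E k + e k" if "k \<le> n" for k n
  proof -
    have "E n \<le> E k + (\<Sum>l<n-k. b (Suc (k + l)) * T (k + l))"
      using truncated_expectation_increment[of Z b T k "n-k"] assms that by (simp add: E_def)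
    also have "(\<Sum>l<n-k. b (Suc (k + l)) * T (k + l)) \<le> e k"
      unfolding e_def using b0 T0 by (intro sum_le_suminf sum') auto
    finally show ?thesis by simp
  qed
  have incE: "incseq E"
    unfolding E_def incseq_def using b(1)
    by (auto intro!: integral_mono int simp: min.coboundedI2 mono_def)
  have "\<forall>n. E n \<le> E 0 + e 0"
    using upper[of 0] by simp
  with incE obtain e' where e': "E \<longlonglongrightarrow> e'"
    by (rule incseq_convergent)
  have lim: "(\<lambda>n. min (Z \<omega>) (b n)) \<longlonglongrightarrow> Z \<omega>" for \<omega>
  proof (rule tendsto_eventually)
    have "\<forall>\<^sub>F n in sequentially. Z \<omega> \<le> b n"
      using b(3) by (simp add: filterlim_at_top)
    then show "\<forall>\<^sub>F n in sequentially. min (Z \<omega>) (b n) = Z \<omega>"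
      by eventually_elim simp
  qed
  have mono: "mono (\<lambda>n. min (Z \<omega>) (b n))" for \<omega>
    using b(1) by (auto simp: mono_def min.coboundedI2)
  show "integrable M Z"
    by (rule integrable_monotone_convergence[OF int _ _ e'[unfolded E_def]]) (use lim mono in auto)
  have "expectation Z = e'"
    by (rule integral_monotone_convergence[OF int _ _ e'[unfolded E_def]]) (use lim mono in auto)
  moreover have "e' \<le> E k + e k"
    by (rule LIMSEQ_le_const2[OF e']) (use upper in blast)
  ultimately show "expectation Z - expectation (\<lambda>\<omega>. min (Z \<omega>) (b k)) \<le> (\<Sum>l. b (Suc (k + l)) * T (k + l))"
    by (simp add: E_def e_def)
qed


text \<open>Outside an event of the stated probability no Z i with i \<le> 2^m exceeds b (m + 1),
  and all block sums of the truncations and of their increments deviate by less than w k. Chaining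
  then costs 2 w k at scale k. The factor 3 in \<open>large\<close> is 2 for the means of the
  increments, which occur once in U and once in centering, and 1 for the bias of the top
  truncation.\<close>

lemma dyadic_maximal_probability:
  fixes Z :: "nat \<Rightarrow> 'a \<Rightarrow> real" and b T w :: "nat \<Rightarrow> real"
  assumes Z [measurable]: "\<And>i. Z i \<in> borel_measurable M" and pos: "\<And>i \<omega>. Z i \<omega> \<ge> 0"
    and var: "\<And>s n f B. n \<ge> 1 \<Longrightarrow> mono f \<Longrightarrow> (\<And>x. \<bar>f x\<bar> \<le> B) \<Longrightarrow>
        variance (\<lambda>\<omega>. \<Sum>i\<in>{s+1..s+n}. f (Z i \<omega>)) \<le> C * (\<Sum>i\<in>{s+1..s+n}. variance (\<lambda>\<omega>. f (Z i \<omega>)))"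
    and "C \<ge> 0"
    and b: "mono b" "b 0 \<ge> 0" "filterlim b at_top sequentially"
    and tail: "\<And>i l. i \<ge> 1 \<Longrightarrow> prob {\<omega>\<in>space M. Z i \<omega> > b l} \<le> T l"
    and sum: "summable (\<lambda>l. b (Suc l) * T l)"
    and w: "\<And>k. w k > 0"
    and large: "(\<Sum>k\<le>m. 2 * w k) + 3 * (\<Sum>k\<le>m. 2 ^ k * (\<Sum>l. b (Suc (k + l)) * T (k + l))) \<le> c"
  shows "prob {\<omega>\<in>space M. \<exists>j\<in>{1..2^m}. \<bar>\<Sum>i=1..j. Z i \<omega> - expectation (Z i)\<bar> > c}
     \<le> 2 ^ m * T (Suc m) + (\<Sum>k\<le>m. 4 * C * 2 ^ m * ((b 0)\<^sup>2 + (\<Sum>l\<le>k. (b (Suc l))\<^sup>2 * T l)) / (w k)\<^sup>2)"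
proof -
  have bk: "b k \<ge> 0" for k
    using b monoD[OF b(1), of 0 k] by simp
  have b_Suc: "b k \<le> b (Suc k)" for k
    using b(1) by (simp add: monoD)
  have T0: "T l \<ge> 0" for l
    using tail[of 1 l] measure_nonneg order_trans by blast
  define e where "e k = (\<Sum>l. b (Suc (k + l)) * T (k + l))" for k
  have e0: "e k \<ge> 0" for k
    unfolding e_def using summable_ignore_initial_segment[OF sum, of k] bk T0
    by (intro suminf_nonneg) (auto simp: add.commute)
  define G where "G k = (b 0)\<^sup>2 + (\<Sum>l\<le>k. (b (Suc l))\<^sup>2 * T l)" for k
  \<comment> \<open>Clipping at 0 as well makes F k bounded on the whole line, as \<open>var\<close>
    requires, without effect on the nonnegative Z.\<close>
  define F where "F k x = min (max 0 x) (b k)" for k x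
  define D where "D k x = F (Suc k) x - F k x" for k x
  have F_mono: "mono (F k)" for k
    by (auto simp: mono_def F_def)
  have F_meas [measurable]: "F k \<in> borel_measurable borel" for k
    using F_mono by (rule borel_measurable_mono)
  have F_bound: "\<bar>F k x\<bar> \<le> b k" for k x
    using bk[of k] by (auto simp: F_def)
  \<comment> \<open>A difference of monotone functions need not be monotone. Here it is the
    overshoot above b k, clipped at b (k + 1) - b k, so \<open>var\<close> applies to D k
    too.\<close>
  have D_eq: "D k x = max 0 (min (max 0 x - b k) (b (Suc k) - b k))" for k x
    using b_Suc[of k] bk[of k] by (auto simp: D_def F_def min_def max_def)
  have D_mono: "mono (D k)" for k
    unfolding mono_def D_eq by (auto intro!: max.mono min.mono)
  have D_meas [measurable]: "D k \<in> borel_measurable borel" for k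
    using D_mono by (rule borel_measurable_mono)
  have D0: "D k x \<ge> 0" for k x
    unfolding D_eq by simp
  have DF: "D k x \<le> F (Suc k) x" for k x
    using bk[of k] by (auto simp: D_def F_def)
  have D_bound: "\<bar>D k x\<bar> \<le> b (Suc k)" for k x
    using DF[of k x] D0[of k x] F_bound[of "Suc k" x] by simp
  have FZ: "F k (Z i \<omega>) = min (Z i \<omega>) (b k)" for k i \<omega>
    using pos[of i \<omega>] by (simp add: F_def)
  have Fint: "integrable M (\<lambda>\<omega>. F k (Z i \<omega>))" for k i
    by (intro integrable_const_bound[of _ "b k"]) (use F_bound in auto)
  have Zint: "integrable M (Z i)" if "i \<ge> 1" for i
    using truncation_bias(1)[OF Z pos b tail[OF that] sum] .
  have bias: "expectation (Z i) - expectation (\<lambda>\<omega>. F k (Z i \<omega>)) \<le> e k" if "i \<ge> 1" for i k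
    using truncation_bias(2)[OF Z pos b tail[OF that] sum] by (simp add: FZ e_def)
  have Z_ge: "expectation (\<lambda>\<omega>. F k (Z i \<omega>)) \<le> expectation (Z i)" if "i \<ge> 1" for i k
    by (intro integral_mono Fint Zint that) (simp add: FZ)
  \<comment> \<open>The mean of F (k + 1) is at most that of Z, so the mean increment is bounded by
    the bias at level b k.\<close>
  have Dexp: "expectation (\<lambda>\<omega>. D k (Z i \<omega>)) \<le> e k" if "i \<ge> 1" for i k
    using bias[OF that, of k] Z_ge[OF that, of "Suc k"] Fint by (simp add: D_def)
  have Dexp0: "expectation (\<lambda>\<omega>. D k (Z i \<omega>)) \<ge> 0" for i k
    by (simp add: D0)
  have GF: "expectation (\<lambda>\<omega>. (F (Suc k) (Z i \<omega>))\<^sup>2) \<le> G k" if "i \<ge> 1" for i k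
    using truncated_second_moment[OF Z pos b(1,2) tail[OF that], of "Suc k"]
    by (simp add: FZ G_def lessThan_Suc_atMost)
  have GD: "expectation (\<lambda>\<omega>. (D k (Z i \<omega>))\<^sup>2) \<le> G k" if "i \<ge> 1" for i k
  proof -
    have "expectation (\<lambda>\<omega>. (D k (Z i \<omega>))\<^sup>2) \<le> expectation (\<lambda>\<omega>. (F (Suc k) (Z i \<omega>))\<^sup>2)"
    proof (rule integral_mono)
      have "\<bar>F (Suc k) x\<bar>\<^sup>2 \<le> (b (Suc k))\<^sup>2" "\<bar>D k x\<bar>\<^sup>2 \<le> (b (Suc k))\<^sup>2" for x
        by (intro power_mono F_bound D_bound; simp)+
      then show "integrable M (\<lambda>\<omega>. (D k (Z i \<omega>))\<^sup>2)" "integrable M (\<lambda>\<omega>. (F (Suc k) (Z i \<omega>))\<^sup>2)"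
        by (intro integrable_const_bound[of _ "(b (Suc k))\<^sup>2"]; simp)+
    qed (use D0 DF in \<open>auto intro: power_mono\<close>)
    with GF[OF that, of k] show ?thesis by simp
  qed
  define dev where "dev f v k \<omega> = \<bar>\<Sum>i\<in>{v * 2^k + 1..v * 2^k + 2^k}. f (Z i \<omega>) - expectation (\<lambda>\<omega>. f (Z i \<omega>))\<bar>"
    for f :: "real \<Rightarrow> real" and v k :: nat and \<omega>
  have dev_prob: "prob {\<omega>\<in>space M. dev f v k \<omega> \<ge> w k} \<le> C * 2 ^ k * G k / (w k)\<^sup>2"
    if "f = F (Suc k) \<or> f = D k" for f v k
  proof -
    have f: "mono f" "\<And>x. \<bar>f x\<bar> \<le> b (Suc k)"
      using that F_mono D_mono F_bound D_bound by auto
    have "prob {\<omega>\<in>space M. dev f v k \<omega> \<ge> w k} \<le> C * real (2 ^ k) * G k / (w k)\<^sup>2"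
      unfolding dev_def
      by (rule block_deviation[OF Z var[OF _ f] f]) (use that GF GD \<open>C \<ge> 0\<close> w in auto)
    then show ?thesis by simp
  qed
  define big where "big = (\<Union>i\<in>{1..2^m}. {\<omega>\<in>space M. Z i \<omega> > b (Suc m)})"
  \<comment> \<open>The index v = 2^(m-k) is included because j = 2^m attains it; that block lies
    beyond 2^m. The 2^(m-k) + 1 blocks are at most 2 * 2^(m-k), which with the two functions per
    block explains the factor 4 in the bound.\<close>
  define bad where "bad k = (\<Union>v\<in>{..2^(m-k)}. {\<omega>\<in>space M. dev (F (Suc k)) v k \<omega> \<ge> w k} \<union> {\<omega>\<in>space M. dev (D k) v k \<omega> \<ge> w k})" for k
  have dev_meas [measurable]: "dev (F n) v k \<in> borel_measurable M" "dev (D n) v k \<in> borel_measurable M" for n v k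
    unfolding dev_def by measurable
  have sets [measurable]: "big \<in> events" "bad k \<in> events" for k
    unfolding big_def bad_def by measurable
  have "prob big \<le> (\<Sum>i\<in>{1..2^m}. prob {\<omega>\<in>space M. Z i \<omega> > b (Suc m)})"
    unfolding big_def by (intro finite_measure_subadditive_finite) auto
  also have "\<dots> \<le> (\<Sum>i\<in>{1..2^m::nat}. T (Suc m))"
    by (intro sum_mono tail) auto
  finally have big: "prob big \<le> 2 ^ m * T (Suc m)" by simp
  have bad: "prob (bad k) \<le> 4 * C * 2 ^ m * G k / (w k)\<^sup>2" if "k \<le> m" for k
  proof -
    have G0: "G k \<ge> 0" unfolding G_def using T0 by (intro add_nonneg_nonneg sum_nonneg) auto
    have "prob (bad k) \<le> (\<Sum>v\<in>{..2^(m-k)}. prob ({\<omega>\<in>space M. dev (F (Suc k)) v k \<omega> \<ge> w k} \<union> {\<omega>\<in>space M. dev (D k) v k \<omega> \<ge> w k}))"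
      unfolding bad_def by (intro finite_measure_subadditive_finite) auto
    also have "\<dots> \<le> (\<Sum>v\<in>{..(2::nat)^(m-k)}. 2 * (C * 2 ^ k * G k / (w k)\<^sup>2))"
    proof (rule sum_mono)
      fix v :: nat
      have "prob ({\<omega>\<in>space M. dev (F (Suc k)) v k \<omega> \<ge> w k} \<union> {\<omega>\<in>space M. dev (D k) v k \<omega> \<ge> w k})
         \<le> prob {\<omega>\<in>space M. dev (F (Suc k)) v k \<omega> \<ge> w k} + prob {\<omega>\<in>space M. dev (D k) v k \<omega> \<ge> w k}"
        by (intro measure_Un_le) auto
      then show "prob ({\<omega>\<in>space M. dev (F (Suc k)) v k \<omega> \<ge> w k} \<union> {\<omega>\<in>space M. dev (D k) v k \<omega> \<ge> w k}) \<le> 2 * (C * 2 ^ k * G k / (w k)\<^sup>2)"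
        using dev_prob[of "F (Suc k)" k v] dev_prob[of "D k" k v] by simp
    qed
    also have "\<dots> = (2 ^ (m-k) + 1) * (2 * (C * 2 ^ k * G k / (w k)\<^sup>2))"
      by simp
    also have "\<dots> \<le> (2 * 2 ^ (m-k)) * (2 * (C * 2 ^ k * G k / (w k)\<^sup>2))"
      using \<open>C \<ge> 0\<close> G0 by (intro mult_right_mono) auto
    also have "\<dots> = 4 * C * (2 ^ (m-k) * 2 ^ k) * G k / (w k)\<^sup>2" by (simp add: field_simps)
    also have "(2::real) ^ (m-k) * 2 ^ k = 2 ^ m" using that by (simp flip: power_add)
    finally show ?thesis .
  qed
  have "{\<omega>\<in>space M. \<exists>j\<in>{1..2^m}. \<bar>\<Sum>i=1..j. Z i \<omega> - expectation (Z i)\<bar> > c} \<subseteq> big \<union> (\<Union>k\<in>{..m}. bad k)"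
  proof (rule subsetI, rule ccontr)
    fix \<omega>
    assume "\<omega> \<in> {\<omega>\<in>space M. \<exists>j\<in>{1..2^m}. \<bar>\<Sum>i=1..j. Z i \<omega> - expectation (Z i)\<bar> > c}"
    then obtain j where \<omega>: "\<omega> \<in> space M" and j: "j \<ge> 1" "j \<le> 2 ^ m"
      and gt: "\<bar>\<Sum>i=1..j. Z i \<omega> - expectation (Z i)\<bar> > c"
      by auto
    assume "\<omega> \<notin> big \<union> (\<Union>k\<in>{..m}. bad k)"
    then have nbig: "\<omega> \<notin> big" and nbad: "\<And>k. k \<le> m \<Longrightarrow> \<omega> \<notin> bad k"
      by auto
    define W where "W k i = F k (Z i \<omega>) - expectation (\<lambda>\<omega>. F k (Z i \<omega>))" for k i
    define U where "U k i = D k (Z i \<omega>) + expectation (\<lambda>\<omega>. D k (Z i \<omega>))" for k i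
    have dev_lt: "dev (F (Suc k)) v k \<omega> < w k" "dev (D k) v k \<omega> < w k" if "k < Suc m" "v \<le> j div 2^k" for k v
    proof -
      have "j div 2^k \<le> 2 ^ m div 2 ^ k" using j by (rule_tac div_le_mono)
      also have "\<dots> = 2 ^ (m - k)" using that by (simp add: power_diff)
      finally have "v \<in> {..2^(m-k)}" using that by simp
      moreover have "\<omega> \<notin> bad k" using that(1) by (intro nbad) simp
      ultimately have "\<omega> \<notin> {\<omega>\<in>space M. dev (F (Suc k)) v k \<omega> \<ge> w k}" "\<omega> \<notin> {\<omega>\<in>space M. dev (D k) v k \<omega> \<ge> w k}"
        unfolding bad_def by blast+
      with \<omega> show "dev (F (Suc k)) v k \<omega> < w k" "dev (D k) v k \<omega> < w k"
        by (simp_all add: not_le)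
    qed
    \<comment> \<open>Starting one scale above m makes the chain begin at 0 for all j, including j = 2^m.\<close>
    have "(2::nat) ^ m < 2 ^ Suc m" by simp
    with j(2) have "j < 2 ^ Suc m" by (rule le_less_trans)
    then have "j div 2 ^ Suc m = 0" by (rule div_less)
    then have "\<bar>\<Sum>i=1..j. W (Suc m) i\<bar> = \<bar>\<Sum>i\<in>{j div 2^Suc m * 2^Suc m + 1..j}. W (Suc m) i\<bar>"
      by simp
    also have "\<dots> \<le> (\<Sum>k<Suc m. w k + (w k + 2 * 2 ^ k * e k))"
    proof (rule dyadic_remainder_bound[where U = U])
      fix k v :: nat assume kv: "k < Suc m" "v \<le> j div 2^k"
      show "\<bar>\<Sum>i\<in>{v * 2^k + 1..v * 2^k + 2^k}. W (Suc k) i\<bar> \<le> w k"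
        using dev_lt(1)[OF kv] unfolding dev_def W_def by simp
      \<comment> \<open>U is the centered increment plus twice its mean: the first part is
        controlled by the event for D k, the second by the bias.\<close>
      have "(\<Sum>i\<in>{v * 2^k + 1..v * 2^k + 2^k}. U k i)
          = (\<Sum>i\<in>{v * 2^k + 1..v * 2^k + 2^k}. D k (Z i \<omega>) - expectation (\<lambda>\<omega>. D k (Z i \<omega>)))
          + (\<Sum>i\<in>{v * 2^k + 1..v * 2^k + 2^k}. 2 * expectation (\<lambda>\<omega>. D k (Z i \<omega>)))"
        unfolding sum.distrib[symmetric] U_def by (rule sum.cong) auto
      also have "\<dots> \<le> w k + (\<Sum>i\<in>{v * 2^k + 1..v * 2^k + 2^k}. 2 * e k)"
        using dev_lt(2)[OF kv] Dexp unfolding dev_def by (intro add_mono sum_mono) auto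
      also have "\<dots> = w k + 2 * 2 ^ k * e k" by simp
      finally show "(\<Sum>i\<in>{v * 2^k + 1..v * 2^k + 2^k}. U k i) \<le> w k + 2 * 2 ^ k * e k" .
    next
      fix k i :: nat
      have "W (Suc k) i - W k i = D k (Z i \<omega>) - expectation (\<lambda>\<omega>. D k (Z i \<omega>))"
        using Fint by (simp add: W_def D_def)
      then show "\<bar>W (Suc k) i - W k i\<bar> \<le> U k i"
        using D0[of k "Z i \<omega>"] Dexp0[of k i] by (simp add: U_def)
    qed
    finally have 1: "\<bar>\<Sum>i=1..j. W (Suc m) i\<bar> \<le> (\<Sum>k<Suc m. w k + (w k + 2 * 2 ^ k * e k))" .
    \<comment> \<open>Off \<open>big\<close> the top truncation leaves each Z i with i \<le> j
      unchanged, so the difference is a deterministic bias.\<close>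
    have "(\<Sum>i=1..j. Z i \<omega> - expectation (Z i)) - (\<Sum>i=1..j. W (Suc m) i)
       = - (\<Sum>i=1..j. expectation (Z i) - expectation (\<lambda>\<omega>. F (Suc m) (Z i \<omega>)))"
      unfolding sum_subtractf[symmetric] sum_negf[symmetric]
    proof (rule sum.cong)
      fix i assume i: "i \<in> {1..j}"
      with j(2) have "i \<in> {1..2^m}" by simp
      with nbig \<omega> have "Z i \<omega> \<le> b (Suc m)" unfolding big_def by (auto simp: not_less)
      then show "Z i \<omega> - expectation (Z i) - W (Suc m) i = - (expectation (Z i) - expectation (\<lambda>\<omega>. F (Suc m) (Z i \<omega>)))"
        by (simp add: W_def FZ)
    qed simp
    moreover have "0 \<le> (\<Sum>i=1..j. expectation (Z i) - expectation (\<lambda>\<omega>. F (Suc m) (Z i \<omega>)))"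
      using Z_ge by (intro sum_nonneg) auto
    moreover have "(\<Sum>i=1..j. expectation (Z i) - expectation (\<lambda>\<omega>. F (Suc m) (Z i \<omega>))) \<le> 2 ^ m * e m"
    proof -
      have "(\<Sum>i=1..j. expectation (Z i) - expectation (\<lambda>\<omega>. F (Suc m) (Z i \<omega>))) \<le> (\<Sum>i=1..j. e m)"
      proof (rule sum_mono)
        fix i assume "i \<in> {1..j}"
        then have i: "i \<ge> 1" by simp
        \<comment> \<open>The bias at level b (m + 1) is at most that at b m, so that it can be
          absorbed as the term k = m of the sum in \<open>large\<close>.\<close>
        have "expectation (\<lambda>\<omega>. F m (Z i \<omega>)) \<le> expectation (\<lambda>\<omega>. F (Suc m) (Z i \<omega>))"
          using b_Suc[of m] by (intro integral_mono Fint) (auto simp: FZ)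
        with bias[OF i, of m] show "expectation (Z i) - expectation (\<lambda>\<omega>. F (Suc m) (Z i \<omega>)) \<le> e m" by simp
      qed
      also have "\<dots> = real j * e m" by simp
      also have "\<dots> \<le> 2 ^ m * e m"
      proof (rule mult_right_mono)
        show "real j \<le> 2 ^ m"
          using j(2) by (metis of_nat_le_iff of_nat_numeral of_nat_power)
      qed (rule e0)
      finally show ?thesis .
    qed
    moreover have "2 ^ m * e m \<le> (\<Sum>k\<le>m. 2 ^ k * e k)"
      by (rule member_le_sum) (use e0 in auto)
    moreover have "(\<Sum>k<Suc m. w k + (w k + 2 * 2 ^ k * e k)) = (\<Sum>k\<le>m. 2 * w k) + 2 * (\<Sum>k\<le>m. 2 ^ k * e k)"
      unfolding lessThan_Suc_atMost sum_distrib_left sum.distrib[symmetric] by (rule sum.cong) auto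
    ultimately have "\<bar>\<Sum>i=1..j. Z i \<omega> - expectation (Z i)\<bar> \<le> c"
      using 1 large unfolding e_def[symmetric] by linarith
    with gt show False by simp
  qed
  then have "prob {\<omega>\<in>space M. \<exists>j\<in>{1..2^m}. \<bar>\<Sum>i=1..j. Z i \<omega> - expectation (Z i)\<bar> > c} \<le> prob (big \<union> (\<Union>k\<in>{..m}. bad k))"
    by (intro finite_measure_mono) auto
  also have "\<dots> \<le> prob big + prob (\<Union>k\<in>{..m}. bad k)"
    by (intro measure_Un_le) auto
  also have "prob (\<Union>k\<in>{..m}. bad k) \<le> (\<Sum>k\<le>m. prob (bad k))"
    by (intro finite_measure_subadditive_finite) auto
  also have "\<dots> \<le> (\<Sum>k\<le>m. 4 * C * 2 ^ m * G k / (w k)\<^sup>2)"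
    by (intro sum_mono bad) auto
  finally show ?thesis
    using big unfolding G_def by simp
qed

section \<open>Summation of the maximal inequality over the scales\<close>

lemma dyadic_maximal_summable:
  fixes Z :: "nat \<Rightarrow> 'a \<Rightarrow> real" and b T :: "nat \<Rightarrow> real" and C u :: real
  assumes Z [measurable]: "\<And>i. Z i \<in> borel_measurable M" and pos: "\<And>i \<omega>. Z i \<omega> \<ge> 0"
    and var: "\<And>s n f B. n \<ge> 1 \<Longrightarrow> mono f \<Longrightarrow> (\<And>x. \<bar>f x\<bar> \<le> B) \<Longrightarrow>
        variance (\<lambda>\<omega>. \<Sum>i\<in>{s+1..s+n}. f (Z i \<omega>)) \<le> C * (\<Sum>i\<in>{s+1..s+n}. variance (\<lambda>\<omega>. f (Z i \<omega>)))"
    and "C \<ge> 0"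
    and b0: "b 0 > 0" and growth: "\<And>k. \<rho> * b k \<le> b (Suc k)" and ratio: "\<And>k. b (Suc k) \<le> R * b k"
    and u: "2 \<le> u" "u < \<rho>\<^sup>2" and "\<rho> > 0"
    and grow: "\<And>k l. k0 \<le> k \<Longrightarrow> k \<le> l \<Longrightarrow> 2 ^ k * b l \<le> K * u ^ l * b k"
    and tail: "\<And>i l. i \<ge> 1 \<Longrightarrow> prob {\<omega>\<in>space M. Z i \<omega> > b l} \<le> T l"
    and sum: "summable (\<lambda>l. u ^ l * T l)"
    and "\<epsilon> > 0"
  shows "\<And>i. i \<ge> 1 \<Longrightarrow> integrable M (Z i)"
    and "summable (\<lambda>m. (u / 2) ^ m * prob {\<omega>\<in>space M. \<exists>j\<in>{1..2^m}. \<bar>\<Sum>i=1..j. Z i \<omega> - expectation (Z i)\<bar> > \<epsilon> * b m})"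
proof -
  have \<rho>: "\<rho> > 1"
  proof (rule ccontr)
    assume "\<not> \<rho> > 1"
    then have "\<rho>\<^sup>2 \<le> 1" using \<open>\<rho> > 0\<close> by (simp add: power_le_one)
    with u show False by simp
  qed
  have bpos: "b k > 0" for k
  proof (induction k)
    case (Suc k)
    then have "0 < \<rho> * b k" using \<rho> by simp
    with growth[of k] show ?case by simp
  qed (rule b0)
  have b_Suc: "b k \<le> b (Suc k)" for k
  proof -
    have "1 * b k \<le> \<rho> * b k" using \<rho> bpos[of k] by (intro mult_right_mono) auto
    with growth[of k] show ?thesis by simp
  qed
  then have mono: "mono b" by (simp add: incseq_SucI)
  have geo: "\<rho> ^ n * b k \<le> b (k + n)" for n k
  proof (induction n)
    case (Suc n)
    then have "\<rho> * (\<rho> ^ n * b k) \<le> \<rho> * b (k + n)" using \<rho> by (intro mult_left_mono) auto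
    with growth[of "k + n"] show ?case by (simp add: mult.assoc)
  qed simp
  have lim: "filterlim b at_top sequentially"
  proof (rule filterlim_at_top_mono)
    show "filterlim (\<lambda>n. \<rho> ^ n * b 0) at_top sequentially"
      using \<rho> b0
      by (intro filterlim_at_top_mult_tendsto_pos[OF tendsto_const]
          filterlim_at_infinity_imp_filterlim_at_top filterlim_realpow_sequentially_gt1) auto
    show "\<forall>\<^sub>F n in sequentially. \<rho> ^ n * b 0 \<le> b n"
      using geo[of _ 0] by simp
  qed
  have T0: "T l \<ge> 0" for l
    using tail[of 1 l] measure_nonneg order_trans by blast
  have "0 < R * b 0" using bpos[of 1] ratio[of 0] by simp
  then have R0: "R > 0" using b0 zero_less_mult_pos2 by blast
  have grow': "2 ^ k * b (Suc l) \<le> R * K * u ^ l * b k" if "k0 \<le> k" "k \<le> l" for k l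
  proof -
    have "2 ^ k * b (Suc l) \<le> R * (2 ^ k * b l)"
      using ratio[of l] by (simp add: mult.left_commute)
    also have "\<dots> \<le> R * (K * u ^ l * b k)"
      using grow[OF that] R0 by (intro mult_left_mono) auto
    finally show ?thesis by (simp add: mult_ac)
  qed
  \<comment> \<open>With its first index frozen at k0, \<open>grow'\<close> bounds b (l + 1) by a
    constant multiple of u^l.\<close>
  have sum': "summable (\<lambda>l. b (Suc l) * T l)"
  proof (rule summable_comparison_test_ev)
    show "summable (\<lambda>l. (R * K * b k0 / 2 ^ k0) * (u ^ l * T l))"
      by (intro summable_mult sum)
    show "\<forall>\<^sub>F l in sequentially. norm (b (Suc l) * T l) \<le> (R * K * b k0 / 2 ^ k0) * (u ^ l * T l)"
      using eventually_ge_at_top[of k0]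
    proof eventually_elim
      case (elim l)
      have "b (Suc l) \<le> R * K * b k0 / 2 ^ k0 * u ^ l"
        using grow'[OF order_refl elim] by (simp add: field_simps)
      from mult_right_mono[OF this T0[of l]] show ?case
        using bpos[of "Suc l"] T0[of l] by (simp add: mult.assoc)
    qed
  qed
  show "integrable M (Z i)" if "i \<ge> 1" for i
    by (rule truncation_bias(1)[OF Z pos mono less_imp_le[OF b0] lim tail[OF that] sum'])
  define e where "e k = (\<Sum>l. b (Suc (k + l)) * T (k + l))" for k
  have sum'k: "summable (\<lambda>l. b (Suc (k + l)) * T (k + l))" for k
    using summable_ignore_initial_segment[OF sum', of k] by (simp add: add.commute)
  have sumk: "summable (\<lambda>l. u ^ (l + k) * T (l + k))" for k
    using summable_ignore_initial_segment[OF sum, of k] .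
  have e_le: "2 ^ k * e k \<le> R * K * b k * (\<Sum>l. u ^ (l + k) * T (l + k))" if "k0 \<le> k" for k
  proof -
    have "2 ^ k * e k = (\<Sum>l. 2 ^ k * (b (Suc (k + l)) * T (k + l)))"
      unfolding e_def using suminf_mult[OF sum'k, of "2^k" k] by simp
    also have "\<dots> \<le> (\<Sum>l. R * K * b k * (u ^ (l + k) * T (l + k)))"
    proof (rule suminf_le)
      fix l
      have "2 ^ k * b (Suc (k + l)) * T (k + l) \<le> R * K * u ^ (k + l) * b k * T (k + l)"
        using grow'[of k "k + l"] that T0 by (intro mult_right_mono) auto
      then show "2 ^ k * (b (Suc (k + l)) * T (k + l)) \<le> R * K * b k * (u ^ (l + k) * T (l + k))"
        by (simp add: mult_ac add.commute)
    qed (intro summable_mult sum'k sumk)+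
    also have "\<dots> = R * K * b k * (\<Sum>l. u ^ (l + k) * T (l + k))"
      by (rule suminf_mult[OF sumk])
    finally show ?thesis .
  qed
  \<comment> \<open>By \<open>e_le\<close>, 2^k e k is b k times a tail of a convergent series,
    hence o(b k); geometric growth of b lets b m dominate the sum of the b k. The choice of \<eta>
    turns \<eta> \<rho> / (\<rho> - 1) into \<epsilon>/12, so after the factor 3 this part takes
    \<epsilon>/4, and the fixed initial terms take another \<epsilon>/4 once b m is large.\<close>
  have e_small: "\<forall>\<^sub>F m in sequentially. 3 * (\<Sum>k\<le>m. 2 ^ k * e k) \<le> \<epsilon> / 2 * b m"
  proof -
    define \<eta> where "\<eta> = \<epsilon> / 12 * (\<rho> - 1) / \<rho>"
    have \<eta>: "\<eta> > 0" using \<open>\<epsilon> > 0\<close> \<rho> by (simp add: \<eta>_def)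
    \<comment> \<open>The sign of K is unknown; this shift gives a positive divisor dominating R
      K.\<close>
    have RK: "\<bar>R * K\<bar> + 1 > 0" by simp
    obtain N where N: "\<And>n. n \<ge> N \<Longrightarrow> norm (\<Sum>l. u ^ (l + n) * T (l + n)) < \<eta> / (\<bar>R * K\<bar> + 1)"
      using suminf_exist_split[OF _ sum, of "\<eta> / (\<bar>R * K\<bar> + 1)"] \<eta> by auto
    have le: "2 ^ k * e k \<le> \<eta> * b k" if "k \<ge> max N k0" for k
    proof -
      define S where "S = (\<Sum>l. u ^ (l + k) * T (l + k))"
      have S0: "S \<ge> 0"
        unfolding S_def using u T0 by (intro suminf_nonneg sumk) auto
      have "R * K * S \<le> (\<bar>R * K\<bar> + 1) * (\<eta> / (\<bar>R * K\<bar> + 1))"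
        using N[of k] that S0 unfolding S_def[symmetric] by (intro mult_mono) auto
      also have "\<dots> = \<eta>" using RK by simp
      finally have "R * K * S * b k \<le> \<eta> * b k"
        using bpos[of k] by (intro mult_right_mono) auto
      with e_le[of k] that show ?thesis
        unfolding S_def[symmetric] by (simp add: mult_ac)
    qed
    define c where "c = (\<Sum>k<max N k0. \<bar>2 ^ k * e k\<bar>)"
    have bound: "3 * (\<Sum>k\<le>m. 2 ^ k * e k) \<le> 3 * c + \<epsilon> / 4 * b m" for m
    proof -
      have "(\<Sum>k\<le>m. 2 ^ k * e k) \<le> (\<Sum>k\<le>m. (if k < max N k0 then \<bar>2 ^ k * e k\<bar> else 0) + \<eta> * b k)"
      proof (rule sum_mono)
        fix k
        show "2 ^ k * e k \<le> (if k < max N k0 then \<bar>2 ^ k * e k\<bar> else 0) + \<eta> * b k"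
        proof (cases "k < max N k0")
          case True
          have "0 \<le> \<eta> * b k" using \<eta> bpos[of k] by simp
          then show ?thesis using True by (simp add: add_increasing2)
        next
          case False
          then have "2 ^ k * e k \<le> \<eta> * b k" by (intro le) (simp only: not_less)
          then show ?thesis using False by (simp only: if_False add_0_left)
        qed
      qed
      also have "\<dots> = (\<Sum>k\<in>{..m} \<inter> {k. k < max N k0}. \<bar>2 ^ k * e k\<bar>) + \<eta> * (\<Sum>k\<le>m. b k)"
        by (simp add: sum.distrib sum_distrib_left sum.inter_restrict)
      also have "\<dots> \<le> c + \<epsilon> / 12 * b m"
      proof (rule add_mono)
        show "(\<Sum>k\<in>{..m} \<inter> {k. k < max N k0}. \<bar>2 ^ k * e k\<bar>) \<le> c"
          unfolding c_def by (intro sum_mono2) auto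
        have "\<eta> * (\<Sum>k\<le>m. b k) = \<epsilon> / 12 / \<rho> * ((\<rho> - 1) * (\<Sum>k\<le>m. b k))"
          by (simp add: \<eta>_def)
        also have "\<dots> \<le> \<epsilon> / 12 / \<rho> * (\<rho> * b m)"
          using \<open>\<epsilon> > 0\<close> \<rho> bpos growth
          by (intro mult_left_mono sum_geometric_growth_le) (auto intro: less_imp_le)
        finally show "\<eta> * (\<Sum>k\<le>m. b k) \<le> \<epsilon> / 12 * b m"
          using \<rho> by simp
      qed
      finally show ?thesis by simp
    qed
    have "\<forall>\<^sub>F m in sequentially. 12 * c / \<epsilon> \<le> b m"
      using lim by (simp add: filterlim_at_top)
    then show ?thesis
    proof eventually_elim
      case (elim m)
      then have "3 * c \<le> \<epsilon> / 4 * b m" using \<open>\<epsilon> > 0\<close> by (simp add: field_simps)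
      with bound[of m] show ?case by simp
    qed
  qed
  define \<tau> where "\<tau> = u / \<rho>\<^sup>2"
  have \<tau>: "0 < \<tau>" "\<tau> < 1"
    using u \<rho> by (simp_all add: \<tau>_def)
  \<comment> \<open>Scale k gets the share \<theta>^(m - k) of the deviation; any \<theta> with \<tau> < \<theta>^2 < 1 works.\<close>
  define \<theta> where "\<theta> = sqrt ((1 + \<tau>) / 2)"
  have \<theta>: "0 < \<theta>" "\<theta> < 1" and \<theta>2: "\<theta>\<^sup>2 = (1 + \<tau>) / 2"
    using \<tau> by (simp_all add: \<theta>_def)
  \<comment> \<open>Chebyshev at scale k divides by \<theta>^(2(m-k)), while u^m / (b m)^2 is
    smaller than its value at k by \<tau>^(m-k). The net ratio is \<sigma> < 1.\<close>
  define \<sigma> where "\<sigma> = \<tau> / \<theta>\<^sup>2"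
  have \<sigma>: "0 < \<sigma>" "\<sigma> < 1"
    using \<tau> by (simp_all add: \<sigma>_def \<theta>2)
  \<comment> \<open>Chosen so that the thresholds 2 w k add up to at most \<epsilon>/2 * b m, half
    of the total deviation.\<close>
  define c where "c = \<epsilon> / 4 * (1 - \<theta>)"
  have c: "c > 0" using \<theta> \<open>\<epsilon> > 0\<close> by (simp add: c_def)
  define G where "G k = (b 0)\<^sup>2 + (\<Sum>l\<le>k. (b (Suc l))\<^sup>2 * T l)" for k
  have G0: "G k \<ge> 0" for k
    unfolding G_def using T0 by (intro add_nonneg_nonneg sum_nonneg) auto
  define v where "v k = u ^ k / (b k)\<^sup>2" for k
  have v0: "v k > 0" for k
    using u bpos[of k] by (simp add: v_def)
  have v_le: "v m \<le> v k * \<tau> ^ (m - k)" if "k \<le> m" for k m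
  proof -
    have "(\<rho> ^ (m - k) * b k)\<^sup>2 \<le> (b m)\<^sup>2"
      using geo[of "m - k" k] that \<rho> bpos[of k] by (intro power_mono) auto
    then have "v m \<le> u ^ m / (\<rho> ^ (m - k) * b k)\<^sup>2"
      unfolding v_def using u \<rho> bpos[of k] bpos[of m] by (intro divide_left_mono) (auto intro!: mult_pos_pos)
    also have "u ^ m = u ^ k * u ^ (m - k)" using that by (simp flip: power_add)
    also have "u ^ k * u ^ (m - k) / (\<rho> ^ (m - k) * b k)\<^sup>2 = v k * \<tau> ^ (m - k)"
      by (simp add: v_def \<tau>_def power_mult_distrib power_divide mult.commute flip: power_mult)
    finally show ?thesis .
  qed
  \<comment> \<open>Since b (l + 1) \<le> R b l and v l (b l)^2 = u^l, the products are dominated by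
    the convolution of the summable u^l T l with the powers of \<tau>, plus a geometric term from (b
    0)^2.\<close>
  have vG: "summable (\<lambda>k. v k * G k)"
  proof (rule summable_comparison_test)
    have "summable (\<lambda>l. R\<^sup>2 * (u ^ l * T l))"
      by (intro summable_mult sum)
    then have "summable (\<lambda>k. \<Sum>l\<le>k. R\<^sup>2 * (u ^ l * T l) * \<tau> ^ (k - l))"
      using \<tau> u T0 by (intro summable_convolution_geometric) auto
    moreover have "summable (\<lambda>k. v 0 * (b 0)\<^sup>2 * \<tau> ^ k)"
      using \<tau> by (intro summable_mult summable_geometric) auto
    ultimately show "summable (\<lambda>k. v 0 * (b 0)\<^sup>2 * \<tau> ^ k + (\<Sum>l\<le>k. R\<^sup>2 * (u ^ l * T l) * \<tau> ^ (k - l)))"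
      by (rule summable_add[rotated])
    show "\<exists>N. \<forall>k\<ge>N. norm (v k * G k) \<le> v 0 * (b 0)\<^sup>2 * \<tau> ^ k + (\<Sum>l\<le>k. R\<^sup>2 * (u ^ l * T l) * \<tau> ^ (k - l))"
    proof (intro exI allI impI)
      fix k
      have "v k * (b 0)\<^sup>2 \<le> v 0 * (b 0)\<^sup>2 * \<tau> ^ k"
        using mult_right_mono[OF v_le[of 0 k], of "(b 0)\<^sup>2"] by (simp add: mult_ac)
      moreover have "v k * (\<Sum>l\<le>k. (b (Suc l))\<^sup>2 * T l) \<le> (\<Sum>l\<le>k. R\<^sup>2 * (u ^ l * T l) * \<tau> ^ (k - l))"
        unfolding sum_distrib_left
      proof (rule sum_mono)
        fix l assume "l \<in> {..k}"
        then have "v k * ((b (Suc l))\<^sup>2 * T l) \<le> v l * \<tau> ^ (k - l) * ((R * b l)\<^sup>2 * T l)"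
          using v0 T0 \<tau> bpos[of "Suc l"] ratio[of l] less_imp_le[OF v0[of l]]
          by (intro mult_mono v_le power_mono) auto
        also have "\<dots> = R\<^sup>2 * (u ^ l * T l) * \<tau> ^ (k - l)"
          using bpos[of l] by (simp add: v_def power_mult_distrib)
        finally show "v k * ((b (Suc l))\<^sup>2 * T l) \<le> R\<^sup>2 * (u ^ l * T l) * \<tau> ^ (k - l)" .
      qed
      ultimately show "norm (v k * G k) \<le> v 0 * (b 0)\<^sup>2 * \<tau> ^ k + (\<Sum>l\<le>k. R\<^sup>2 * (u ^ l * T l) * \<tau> ^ (k - l))"
        using mult_nonneg_nonneg[OF less_imp_le[OF v0[of k]] G0[of k]] unfolding G_def distrib_left real_norm_def by linarith
    qed
  qed
  define P where "P m = prob {\<omega>\<in>space M. \<exists>j\<in>{1..2^m}. \<bar>\<Sum>i=1..j. Z i \<omega> - expectation (Z i)\<bar> > \<epsilon> * b m}" for m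
  have "summable (\<lambda>m. (u / 2) ^ m * P m)"
  proof (rule summable_comparison_test_ev)
    have "summable (\<lambda>m. 1 / u * (u ^ Suc m * T (Suc m)))"
      using summable_ignore_initial_segment[OF sum, of 1] by (intro summable_mult) simp
    then have "summable (\<lambda>m. u ^ m * T (Suc m))"
      using u by simp
    moreover have "summable (\<lambda>m. 4 * C / c\<^sup>2 * (\<Sum>k\<le>m. v k * G k * \<sigma> ^ (m - k)))"
      using vG \<sigma> v0 G0 by (intro summable_mult summable_convolution_geometric) (auto simp: less_imp_le)
    ultimately show "summable (\<lambda>m. u ^ m * T (Suc m) + 4 * C / c\<^sup>2 * (\<Sum>k\<le>m. v k * G k * \<sigma> ^ (m - k)))"
      by (rule summable_add)
    show "\<forall>\<^sub>F m in sequentially. norm ((u / 2) ^ m * P m) \<le> u ^ m * T (Suc m) + 4 * C / c\<^sup>2 * (\<Sum>k\<le>m. v k * G k * \<sigma> ^ (m - k))"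
      using e_small
    proof eventually_elim
      case (elim m)
      define w where "w k = c * \<theta> ^ (m - k) * b m" for k
      have w: "w k > 0" for k
        unfolding w_def using c \<theta> bpos[of m] by simp
      have "(\<Sum>k\<le>m. 2 * w k) = \<epsilon> / 2 * b m * ((1 - \<theta>) * (\<Sum>k\<le>m. \<theta> ^ (m - k)))"
        by (simp add: w_def c_def sum_distrib_left mult_ac)
      also have "\<dots> \<le> \<epsilon> / 2 * b m * 1"
        using \<theta> \<open>\<epsilon> > 0\<close> bpos[of m] by (intro mult_left_mono sum_power_diff_le) auto
      finally have large: "(\<Sum>k\<le>m. 2 * w k) + 3 * (\<Sum>k\<le>m. 2 ^ k * e k) \<le> \<epsilon> * b m"
        using elim by (simp add: algebra_simps)
      have "P m \<le> 2 ^ m * T (Suc m) + (\<Sum>k\<le>m. 4 * C * 2 ^ m * G k / (w k)\<^sup>2)"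
        unfolding P_def G_def
        by (rule dyadic_maximal_probability[OF Z pos var \<open>C \<ge> 0\<close> mono less_imp_le[OF b0] lim tail sum' w large[unfolded e_def]])
      then have "(u / 2) ^ m * P m \<le> (u / 2) ^ m * (2 ^ m * T (Suc m) + (\<Sum>k\<le>m. 4 * C * 2 ^ m * G k / (w k)\<^sup>2))"
        using u by (intro mult_left_mono) auto
      also have "\<dots> = u ^ m * T (Suc m) + (\<Sum>k\<le>m. 4 * C * u ^ m * G k / (w k)\<^sup>2)"
        by (simp add: distrib_left power_divide sum_distrib_left mult_ac)
      also have "(\<Sum>k\<le>m. 4 * C * u ^ m * G k / (w k)\<^sup>2) \<le> (\<Sum>k\<le>m. 4 * C / c\<^sup>2 * (v k * G k * \<sigma> ^ (m - k)))"
      proof (rule sum_mono)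
        fix k assume "k \<in> {..m}"
        have "4 * C * u ^ m * G k / (w k)\<^sup>2 = 4 * C / c\<^sup>2 * (v m * G k / (\<theta>\<^sup>2) ^ (m - k))"
          by (simp add: w_def v_def power_mult_distrib mult_ac flip: power_mult)
        also have "\<dots> \<le> 4 * C / c\<^sup>2 * (v k * \<tau> ^ (m - k) * G k / (\<theta>\<^sup>2) ^ (m - k))"
          using \<open>k \<in> {..m}\<close> \<open>C \<ge> 0\<close> G0 by (intro mult_left_mono divide_right_mono mult_right_mono v_le) auto
        also have "\<dots> = 4 * C / c\<^sup>2 * (v k * G k * \<sigma> ^ (m - k))"
          by (simp add: \<sigma>_def power_divide mult_ac)
        finally show "4 * C * u ^ m * G k / (w k)\<^sup>2 \<le> 4 * C / c\<^sup>2 * (v k * G k * \<sigma> ^ (m - k))" .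
      qed
      finally show ?case
        using u by (simp add: P_def abs_mult sum_distrib_left)
    qed
  qed
  then show "summable (\<lambda>m. (u / 2) ^ m * prob {\<omega>\<in>space M. \<exists>j\<in>{1..2^m}. \<bar>\<Sum>i=1..j. Z i \<omega> - expectation (Z i)\<bar> > \<epsilon> * b m})"
    unfolding P_def .
qed

lemma dyadic_maximal_summable_signed:
  fixes X :: "nat \<Rightarrow> 'a \<Rightarrow> real" and b T :: "nat \<Rightarrow> real" and C u :: real
  assumes X [measurable]: "\<And>i. X i \<in> borel_measurable M"
    and var: "\<And>s n f B. n \<ge> 1 \<Longrightarrow> mono f \<Longrightarrow> (\<And>x. \<bar>f x\<bar> \<le> B) \<Longrightarrow>
        variance (\<lambda>\<omega>. \<Sum>i\<in>{s+1..s+n}. f (X i \<omega>)) \<le> C * (\<Sum>i\<in>{s+1..s+n}. variance (\<lambda>\<omega>. f (X i \<omega>)))"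
    and "C \<ge> 0"
    and b0: "b 0 > 0" and growth: "\<And>k. \<rho> * b k \<le> b (Suc k)" and ratio: "\<And>k. b (Suc k) \<le> R * b k"
    and u: "2 \<le> u" "u < \<rho>\<^sup>2" and "\<rho> > 0"
    and grow: "\<And>k l. k0 \<le> k \<Longrightarrow> k \<le> l \<Longrightarrow> 2 ^ k * b l \<le> K * u ^ l * b k"
    and tail: "\<And>i l. i \<ge> 1 \<Longrightarrow> prob {\<omega>\<in>space M. \<bar>X i \<omega>\<bar> > b l} \<le> T l"
    and sum: "summable (\<lambda>l. u ^ l * T l)"
    and "\<epsilon> > 0"
  shows "summable (\<lambda>m. (u / 2) ^ m * prob {\<omega>\<in>space M. \<exists>j\<in>{1..2^m}. \<bar>\<Sum>i=1..j. X i \<omega> - expectation (X i)\<bar> > \<epsilon> * b m})"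
proof -
  define Zp where "Zp i \<omega> = max 0 (X i \<omega>)" for i \<omega>
  define Zn where "Zn i \<omega> = max 0 (- X i \<omega>)" for i \<omega>
  have [measurable]: "Zp i \<in> borel_measurable M" "Zn i \<in> borel_measurable M" for i
    unfolding Zp_def Zn_def by measurable
  have tails: "prob {\<omega>\<in>space M. Zp i \<omega> > b l} \<le> T l" "prob {\<omega>\<in>space M. Zn i \<omega> > b l} \<le> T l" if "i \<ge> 1" for i l
  proof -
    have bl: "b l \<ge> 0"
    proof (induction l)
      case (Suc l)
      then have "0 \<le> \<rho> * b l" using \<open>\<rho> > 0\<close> by simp
      with growth[of l] show ?case by simp
    qed (use b0 in simp)
    have "prob {\<omega>\<in>space M. Zp i \<omega> > b l} \<le> prob {\<omega>\<in>space M. \<bar>X i \<omega>\<bar> > b l}"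
      "prob {\<omega>\<in>space M. Zn i \<omega> > b l} \<le> prob {\<omega>\<in>space M. \<bar>X i \<omega>\<bar> > b l}"
      using bl by (auto intro!: finite_measure_mono simp: Zp_def Zn_def)
    with tail[OF that, of l] show "prob {\<omega>\<in>space M. Zp i \<omega> > b l} \<le> T l" "prob {\<omega>\<in>space M. Zn i \<omega> > b l} \<le> T l"
      by simp_all
  qed
  define P where "P Z e m = prob {\<omega>\<in>space M. \<exists>j\<in>{1..2^m}. \<bar>\<Sum>i=1..j. Z i \<omega> - expectation (Z i)\<bar> > e * b m}"
    for Z :: "nat \<Rightarrow> 'a \<Rightarrow> real" and e and m :: nat
  have half: "\<epsilon> / 2 > 0" using \<open>\<epsilon> > 0\<close> by simp
  have pos: "Zp i \<omega> \<ge> 0" "Zn i \<omega> \<ge> 0" for i \<omega>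
    by (simp_all add: Zp_def Zn_def)
  have meas: "Zp i \<in> borel_measurable M" "Zn i \<in> borel_measurable M" for i
    by measurable
  have varp: "variance (\<lambda>\<omega>. \<Sum>i\<in>{s+1..s+n}. f (Zp i \<omega>)) \<le> C * (\<Sum>i\<in>{s+1..s+n}. variance (\<lambda>\<omega>. f (Zp i \<omega>)))"
    if n: "n \<ge> 1" and f: "mono f" "\<And>x. \<bar>f x\<bar> \<le> B" for s n :: nat and f B
  proof -
    have "mono (\<lambda>x. f (max 0 x))"
      using f(1) by (auto simp: mono_def intro: max.mono)
    from var[OF n this f(2)] show ?thesis
      by (simp add: Zp_def)
  qed
  have varn: "variance (\<lambda>\<omega>. \<Sum>i\<in>{s+1..s+n}. f (Zn i \<omega>)) \<le> C * (\<Sum>i\<in>{s+1..s+n}. variance (\<lambda>\<omega>. f (Zn i \<omega>)))"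
    if n: "n \<ge> 1" and f: "mono f" "\<And>x. \<bar>f x\<bar> \<le> B" for s n :: nat and f :: "real \<Rightarrow> real" and B
  proof -
    have uminus: "variance (\<lambda>\<omega>. - g \<omega>) = variance g" for g :: "'a \<Rightarrow> real"
      by (simp add: power2_commute)
    \<comment> \<open>The negative part is a decreasing function of X, so the variance inequality is
      applied to minus the composition; variances do not see the sign.\<close>
    have "mono (\<lambda>x. - f (max 0 (- x)))"
      using f(1) by (auto simp: mono_def intro: max.mono)
    from var[OF n this, of B s] f(2) show ?thesis
      unfolding sum_negf uminus by (simp add: Zn_def)
  qed
  have int_p: "integrable M (Zp i)" if "i \<ge> 1" for i
    by (rule dyadic_maximal_summable(1)[OF meas(1) pos(1) varp \<open>C \<ge> 0\<close> b0 growth ratio u \<open>\<rho> > 0\<close> grow tails(1) sum half that])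
  have sum_p: "summable (\<lambda>m. (u / 2) ^ m * P Zp (\<epsilon> / 2) m)"
    unfolding P_def
    by (rule dyadic_maximal_summable(2)[OF meas(1) pos(1) varp \<open>C \<ge> 0\<close> b0 growth ratio u \<open>\<rho> > 0\<close> grow tails(1) sum half])
  have int_n: "integrable M (Zn i)" if "i \<ge> 1" for i
    by (rule dyadic_maximal_summable(1)[OF meas(2) pos(2) varn \<open>C \<ge> 0\<close> b0 growth ratio u \<open>\<rho> > 0\<close> grow tails(2) sum half that])
  have sum_n: "summable (\<lambda>m. (u / 2) ^ m * P Zn (\<epsilon> / 2) m)"
    unfolding P_def
    by (rule dyadic_maximal_summable(2)[OF meas(2) pos(2) varn \<open>C \<ge> 0\<close> b0 growth ratio u \<open>\<rho> > 0\<close> grow tails(2) sum half])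
  have X_eq: "X i \<omega> = Zp i \<omega> - Zn i \<omega>" for i \<omega>
    by (simp add: Zp_def Zn_def max_def)
  have EX: "expectation (X i) = expectation (Zp i) - expectation (Zn i)" if "i \<ge> 1" for i
  proof -
    have "X i = (\<lambda>\<omega>. Zp i \<omega> - Zn i \<omega>)" by (rule ext) (rule X_eq)
    then show ?thesis using int_p[OF that] int_n[OF that] by simp
  qed
  have "P X \<epsilon> m \<le> P Zp (\<epsilon> / 2) m + P Zn (\<epsilon> / 2) m" for m
  proof -
    define A where "A Z = {\<omega>\<in>space M. \<exists>j\<in>{1..2^m}. \<bar>\<Sum>i=1..j. Z i \<omega> - expectation (Z i)\<bar> > (\<epsilon> / 2) * b m}" for Z :: "nat \<Rightarrow> 'a \<Rightarrow> real"
    have [measurable]: "A Zp \<in> events" "A Zn \<in> events"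
      unfolding A_def by measurable
    have "{\<omega>\<in>space M. \<exists>j\<in>{1..2^m}. \<bar>\<Sum>i=1..j. X i \<omega> - expectation (X i)\<bar> > \<epsilon> * b m} \<subseteq> A Zp \<union> A Zn"
    proof
      fix \<omega> assume "\<omega> \<in> {\<omega>\<in>space M. \<exists>j\<in>{1..2^m}. \<bar>\<Sum>i=1..j. X i \<omega> - expectation (X i)\<bar> > \<epsilon> * b m}"
      then obtain j where \<omega>: "\<omega> \<in> space M" and j: "j \<in> {1..2^m}"
        and gt: "\<bar>\<Sum>i=1..j. X i \<omega> - expectation (X i)\<bar> > \<epsilon> * b m"
        by blast
      have "(\<Sum>i=1..j. X i \<omega> - expectation (X i))
         = (\<Sum>i=1..j. Zp i \<omega> - expectation (Zp i)) - (\<Sum>i=1..j. Zn i \<omega> - expectation (Zn i))"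
        unfolding sum_subtractf[symmetric] by (rule sum.cong) (simp_all add: EX, simp add: X_eq)
      with gt have "\<bar>\<Sum>i=1..j. Zp i \<omega> - expectation (Zp i)\<bar> > (\<epsilon> / 2) * b m \<or> \<bar>\<Sum>i=1..j. Zn i \<omega> - expectation (Zn i)\<bar> > (\<epsilon> / 2) * b m"
        by (simp add: field_simps) linarith
      with \<omega> j show "\<omega> \<in> A Zp \<union> A Zn" unfolding A_def by blast
    qed
    then have "P X \<epsilon> m \<le> prob (A Zp \<union> A Zn)"
      unfolding P_def by (intro finite_measure_mono) auto
    also have "\<dots> \<le> P Zp (\<epsilon> / 2) m + P Zn (\<epsilon> / 2) m"
      unfolding P_def A_def[symmetric] by (intro measure_Un_le) auto
    finally show ?thesis .
  qed
  then have "(u / 2) ^ m * P X \<epsilon> m \<le> (u / 2) ^ m * P Zp (\<epsilon> / 2) m + (u / 2) ^ m * P Zn (\<epsilon> / 2) m" for m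
    unfolding distrib_left[symmetric] using u by (intro mult_left_mono) auto
  moreover have "0 \<le> (u / 2) ^ m * P X \<epsilon> m" for m
    using u by (simp add: P_def)
  ultimately have "summable (\<lambda>m. (u / 2) ^ m * P X \<epsilon> m)"
    by (intro summable_comparison_test[OF _ summable_add[OF sum_p sum_n]]) auto
  then show ?thesis unfolding P_def .
qed

text \<open>Pointwise, the sum of u^l over those l \<ge> k0 with \<omega> in E l contains only
  powers u^l \<le> H \<omega>, hence is at most 2 H \<omega>; integrating bounds all partial
  sums.\<close>

lemma summable_geometric_tails:
  fixes H :: "'a \<Rightarrow> real"
  assumes E [measurable]: "\<And>l. E l \<in> events" and H: "integrable M H" "\<And>\<omega>. H \<omega> \<ge> 0" and "u \<ge> 2"
    and le: "\<And>l \<omega>. l \<ge> k0 \<Longrightarrow> \<omega> \<in> E l \<Longrightarrow> u ^ l \<le> H \<omega>"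
  shows "summable (\<lambda>l. u ^ l * prob (E l))"
proof -
  have "summable (\<lambda>l. u ^ (l + k0) * prob (E (l + k0)))"
  proof (rule summableI_nonneg_bounded)
    fix N
    have "(\<Sum>l<N. u ^ (l + k0) * prob (E (l + k0))) = expectation (\<lambda>\<omega>. \<Sum>l<N. u ^ (l + k0) * indicator (E (l + k0)) \<omega>)"
      by (subst Bochner_Integration.integral_sum) (auto simp: emeasure_eq_measure)
    also have "\<dots> \<le> expectation (\<lambda>\<omega>. 2 * H \<omega>)"
    proof (rule integral_mono)
      show "integrable M (\<lambda>\<omega>. \<Sum>l<N. u ^ (l + k0) * indicator (E (l + k0)) \<omega>)"
        by (intro Bochner_Integration.integrable_sum integrable_mult_right integrable_real_indicator)
          (auto simp: emeasure_eq_measure)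
      show "integrable M (\<lambda>\<omega>. 2 * H \<omega>)" using H by simp
      fix \<omega>
      have "(\<Sum>l<N. u ^ (l + k0) * indicator (E (l + k0)) \<omega>) \<le> (\<Sum>l<N. if u ^ (l + k0) \<le> H \<omega> then u ^ (l + k0) else 0)"
        using le[of _ \<omega>] \<open>u \<ge> 2\<close> by (intro sum_mono) (auto simp: indicator_def)
      also have "\<dots> = (\<Sum>l\<in>{k0..<N + k0}. if u ^ l \<le> H \<omega> then u ^ l else 0)"
        by (simp add: sum.shift_bounds_nat_ivl[of _ 0 k0 N, simplified] lessThan_atLeast0)
      also have "\<dots> \<le> (\<Sum>l<N + k0. if u ^ l \<le> H \<omega> then u ^ l else 0)"
        using \<open>u \<ge> 2\<close> by (intro sum_mono2) auto
      also have "\<dots> \<le> 2 * H \<omega>"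
        by (rule sum_powers_below[OF \<open>u \<ge> 2\<close> H(2)])
      finally show "(\<Sum>l<N. u ^ (l + k0) * indicator (E (l + k0)) \<omega>) \<le> 2 * H \<omega>" .
    qed
    finally show "(\<Sum>l<N. u ^ (l + k0) * prob (E (l + k0))) \<le> expectation (\<lambda>\<omega>. 2 * H \<omega>)" .
  qed (use \<open>u \<ge> 2\<close> in simp)
  then show ?thesis by (rule summable_iff_shift[of "\<lambda>l. u ^ l * prob (E l)" k0, THEN iffD1])
qed

end

subsection \<open>The Baum--Katz series\<close>

theorem theorem2p1:
  fixes M :: "'a measure" and X :: "nat \<Rightarrow> 'a \<Rightarrow> real" and Y :: "'a \<Rightarrow> real"
    and L Lt :: "real \<Rightarrow> real" and p :: real
  assumes "prob_space M"
    and "\<And>n. X n \<in> borel_measurable M"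
    and "Y \<in> borel_measurable M"
    and "1 \<le> p" and "p < 2"
    and "prob_space.variance_condition M X"
    and "slowly_varying L"
    and "de_bruijn_conjugate L Lt"
    and "standing_assumptions L Lt"
    and "p = 1 \<Longrightarrow> (\<forall>x\<ge>0. L x \<ge> 1) \<and> mono_on {0..} L"
    and "prob_space.stoch_dominated M X Y"
    and "integrable M (\<lambda>\<omega>. \<bar>Y \<omega>\<bar> powr p * \<bar>L \<bar>Y \<omega>\<bar>\<bar> powr p)"
  shows "\<forall>\<alpha>\<ge>1/p. \<forall>\<epsilon>>0. summable (\<lambda>m. let n = Suc m in
           real n powr (\<alpha> * p - 2) *
           measure M {\<omega>\<in>space M.
              Max ((\<lambda>j. \<bar>\<Sum>i=1..j. (X i \<omega> - prob_space.expectation M (X i))\<bar>) ` {1..n})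
                > \<epsilon> * real n powr \<alpha> * Lt (real n powr \<alpha>)})"
proof (intro allI impI)
  interpret prob_space M by fact
  fix \<alpha> \<epsilon> :: real
  assume \<alpha>: "1 / p \<le> \<alpha>" and "\<epsilon> > 0"
  note X [measurable] = assms(2) and Y [measurable] = assms(3)
  have q1: "1 \<le> \<alpha> * p" using \<alpha> \<open>1 \<le> p\<close> by (simp add: field_simps)
  have "\<alpha> > 0" using \<alpha> \<open>1 \<le> p\<close> by (smt (verit) divide_pos_pos)
  define a where "a = 2 powr \<alpha>"
  define u where "u = 2 powr (\<alpha> * p)"
  \<comment> \<open>The exponent is the midpoint of p/2 and 1. Above p/2 it gives u < \<rho>^2;
    below 1 it gives \<rho> < a, so slow variation makes b grow at least by \<rho> per scale
    eventually. Both need p < 2.\<close>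
  define \<rho> where "\<rho> = a powr ((2 + p) / 4)"
  have a1: "a > 1" using \<open>\<alpha> > 0\<close> by (simp add: a_def)
  have ua: "u = a powr p" by (simp add: a_def u_def powr_powr)
  have u2: "u \<ge> 2" using powr_mono[OF q1, of 2] by (simp add: u_def)
  have \<rho>: "\<rho> > 0" "\<rho> < a"
    using powr_less_mono[of "(2 + p) / 4" 1 a] a1 \<open>p < 2\<close> by (simp_all add: \<rho>_def)
  have "\<rho>\<^sup>2 = a powr ((2 + p) / 2)"
    by (simp add: \<rho>_def power2_eq_square flip: powr_add)
  then have u\<rho>: "u < \<rho>\<^sup>2"
    using a1 \<open>p < 2\<close> by (simp add: ua)
  have u_power: "(a ^ l) powr p = u ^ l" for l
    using a1 by (simp add: ua powr_powr mult.commute flip: powr_realpow)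
  have Lpos: "\<forall>\<^sub>F x in at_top. L x > 0"
    using assms(7) by (rule slowly_varying_eventually_pos)
  have Lt: "slowly_varying Lt" and lim: "((\<lambda>x. Lt x * L (x * Lt x)) \<longlongrightarrow> 1) at_top"
    using assms(8) by (simp_all add: de_bruijn_conjugate_def)
  have Ltpos: "\<forall>\<^sub>F x in at_top. Lt x > 0"
    using Lt by (rule slowly_varying_eventually_pos)
  have diff: "\<forall>\<^sub>F x in at_top. L differentiable (at x)"
    using assms(9) unfolding standing_assumptions_def eventually_at_top_linorder by blast
  have mono: "\<forall>\<^sub>F x in at_top. \<forall>y\<ge>x. x * L x \<le> y * L y"
    using assms(9) by (intro eventually_mono_mult_slowly_varying[OF Lpos diff]) (simp add: standing_assumptions_def)
  have top: "filterlim (\<lambda>x. x * Lt x) at_top at_top"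
    using assms(9) by (intro de_bruijn_filterlim[OF _ Ltpos lim]) (simp add: standing_assumptions_def)
  have xtop: "filterlim (\<lambda>k. a ^ k) at_top sequentially"
    using a1 by (intro filterlim_at_infinity_imp_filterlim_at_top filterlim_realpow_sequentially_gt1) auto
  define B where "B k = a ^ k * Lt (a ^ k)" for k
  have Btop: "filterlim B at_top sequentially"
    unfolding B_def by (rule filterlim_compose[OF top xtop])
  obtain \<kappa> where \<kappa>: "\<kappa> > 0" and quasi: "\<forall>\<^sub>F x in at_top. \<forall>z\<in>{x..a * x}. \<kappa> * (z * Lt z) \<le> x * Lt x"
    using de_bruijn_quasi_monotone[OF assms(7) mono top lim, of a] a1 by auto
  from quasi obtain x0 where x0: "\<And>x z. x \<ge> x0 \<Longrightarrow> x \<le> z \<Longrightarrow> z \<le> a * x \<Longrightarrow> \<kappa> * (z * Lt z) \<le> x * Lt x"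
    unfolding eventually_at_top_linorder by force
  obtain K where grow: "\<forall>\<^sub>F k in sequentially. \<forall>l\<ge>k. 2 ^ k * B l \<le> K * u ^ l * B k"
    using de_bruijn_growth[OF Lt top lim a1 ua u2 \<open>1 \<le> p\<close> assms(10)] unfolding B_def by blast

  have lim_ratio: "((\<lambda>k. Lt (a * a ^ k) / Lt (a ^ k)) \<longlongrightarrow> 1) sequentially"
    using a1 by (intro filterlim_compose[OF slowly_varying_tendsto[OF Lt] xtop]) auto
  have "\<rho> / a < 1" using \<rho> a1 by simp
  from order_tendstoD(1)[OF lim_ratio this]
  have "\<forall>\<^sub>F k in sequentially. \<rho> / a < Lt (a * a ^ k) / Lt (a ^ k)" .
  moreover have "\<forall>\<^sub>F k in sequentially. Lt (a * a ^ k) / Lt (a ^ k) < 2"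
    by (rule order_tendstoD(2)[OF lim_ratio]) simp
  moreover have "\<forall>\<^sub>F k in sequentially. Lt (a ^ k) > 0"
    using Ltpos xtop unfolding filterlim_iff by blast
  ultimately have ratios: "\<forall>\<^sub>F k in sequentially. \<rho> * B k \<le> B (Suc k) \<and> B (Suc k) \<le> 2 * a * B k \<and> B k > 0"
  proof eventually_elim
    case (elim k)
    then have "\<rho> * Lt (a ^ k) \<le> a * Lt (a * a ^ k)" "Lt (a * a ^ k) \<le> 2 * Lt (a ^ k)"
      using a1 by (simp_all add: field_simps)
    then have "a ^ k * (\<rho> * Lt (a ^ k)) \<le> a ^ k * (a * Lt (a * a ^ k))"
      "a ^ k * a * Lt (a * a ^ k) \<le> a ^ k * a * (2 * Lt (a ^ k))"
      using a1 by (auto intro!: mult_left_mono)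
    then show ?case using elim a1 by (simp add: B_def mult_ac)
  qed
  have "\<forall>\<^sub>F x in at_top. \<forall>y\<ge>x. L y > 0"
    using Lpos by (rule eventually_all_ge_at_top)
  then have "\<forall>\<^sub>F k in sequentially. \<forall>y\<ge>B k. L y > 0"
    using Btop unfolding filterlim_iff by blast
  moreover have "\<forall>\<^sub>F k in sequentially. \<forall>y\<ge>B k. B k * L (B k) \<le> y * L y"
    using mono Btop unfolding filterlim_iff by blast
  moreover have "\<forall>\<^sub>F k in sequentially. Lt (a ^ k) * L (B k) > 1 / 2"
    by (rule order_tendstoD(1)[OF filterlim_compose[OF lim xtop, folded B_def]]) simp
  \<comment> \<open>The half of asymptotic inversion that is needed: |Y| \<ge> B l forces a^l \<le>
    2 |Y| L |Y|, and the p-th power of this compares u^l with the integrable function of the moment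
    assumption.\<close>
  ultimately have inverse: "\<forall>\<^sub>F k in sequentially. \<forall>y\<ge>B k. L y > 0 \<and> a ^ k \<le> 2 * (y * L y)"
  proof eventually_elim
    case (elim k)
    have "a ^ k * (1 / 2) \<le> a ^ k * (Lt (a ^ k) * L (B k))"
      using elim a1 by (intro mult_left_mono) auto
    then have "a ^ k \<le> 2 * (B k * L (B k))" by (simp add: B_def mult_ac)
    with elim show ?case by force
  qed
  have "\<forall>\<^sub>F k in sequentially. (\<forall>l\<ge>k. 2 ^ k * B l \<le> K * u ^ l * B k)
      \<and> (\<rho> * B k \<le> B (Suc k) \<and> B (Suc k) \<le> 2 * a * B k \<and> B k > 0)
      \<and> (\<forall>y\<ge>B k. L y > 0 \<and> a ^ k \<le> 2 * (y * L y)) \<and> x0 \<le> a ^ k"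
    using grow ratios inverse xtop unfolding filterlim_at_top by (simp add: eventually_conj_iff)
  then obtain k0 where k0: "\<And>k l. k \<ge> k0 \<Longrightarrow> l \<ge> k \<Longrightarrow> 2 ^ k * B l \<le> K * u ^ l * B k"
      "\<And>k. k \<ge> k0 \<Longrightarrow> \<rho> * B k \<le> B (Suc k)" "\<And>k. k \<ge> k0 \<Longrightarrow> B (Suc k) \<le> 2 * a * B k" "\<And>k. k \<ge> k0 \<Longrightarrow> B k > 0"
      "\<And>k y. k \<ge> k0 \<Longrightarrow> y \<ge> B k \<Longrightarrow> L y > 0" "\<And>k y. k \<ge> k0 \<Longrightarrow> y \<ge> B k \<Longrightarrow> a ^ k \<le> 2 * (y * L y)"
      "\<And>k. k \<ge> k0 \<Longrightarrow> x0 \<le> a ^ k"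
    unfolding eventually_sequentially by blast
  have "\<rho> \<le> 2 * a" using \<rho> a1 by simp
  obtain b where b: "\<And>k. k \<ge> k0 \<Longrightarrow> b k = B k" "\<And>k. b k > 0"
      "\<And>k. \<rho> * b k \<le> b (Suc k)" "\<And>k. b (Suc k) \<le> 2 * a * b k"
    using geometric_extension[OF k0(4)[OF order_refl] \<rho>(1) \<open>\<rho> \<le> 2 * a\<close> k0(2,3)] by blast
  define T where "T l = prob {\<omega>\<in>space M. \<bar>Y \<omega>\<bar> > b l}" for l
  have tail: "prob {\<omega>\<in>space M. \<bar>X i \<omega>\<bar> > b l} \<le> T l" if "i \<ge> 1" for i l
  proof -
    \<comment> \<open>A real supremum bounds its members only if the set is bounded above; here 1 is
      a bound.\<close>
    have "prob {\<omega>\<in>space M. \<bar>X i \<omega>\<bar> > b l} \<le> (SUP i\<in>{1..}. prob {\<omega>\<in>space M. \<bar>X i \<omega>\<bar> > b l})"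
      using that by (intro cSUP_upper) (auto intro!: bdd_aboveI[of _ 1])
    also have "\<dots> \<le> T l"
      using assms(11) b(2)[of l] unfolding stoch_dominated_def T_def by (simp add: less_imp_le)
    finally show ?thesis .
  qed
  have sum: "summable (\<lambda>l. u ^ l * T l)"
    unfolding T_def
  proof (rule summable_geometric_tails)
    show "integrable M (\<lambda>\<omega>. 2 powr p * (\<bar>Y \<omega>\<bar> powr p * \<bar>L \<bar>Y \<omega>\<bar>\<bar> powr p))"
      using assms(12) by simp
    fix l \<omega> assume "k0 \<le> l" "\<omega> \<in> {\<omega>\<in>space M. \<bar>Y \<omega>\<bar> > b l}"
    then have y: "B l \<le> \<bar>Y \<omega>\<bar>" using b(1)[of l] by simp
    have "u ^ l = (a ^ l) powr p" by (rule u_power[symmetric])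
    also have "\<dots> \<le> (2 * (\<bar>Y \<omega>\<bar> * L \<bar>Y \<omega>\<bar>)) powr p"
      using k0(6)[OF \<open>k0 \<le> l\<close> y] a1 \<open>1 \<le> p\<close> by (intro powr_mono2) auto
    also have "\<dots> = 2 powr p * (\<bar>Y \<omega>\<bar> powr p * \<bar>L \<bar>Y \<omega>\<bar>\<bar> powr p)"
      using k0(5)[OF \<open>k0 \<le> l\<close> y] by (simp add: powr_mult)
    finally show "u ^ l \<le> 2 powr p * (\<bar>Y \<omega>\<bar> powr p * \<bar>L \<bar>Y \<omega>\<bar>\<bar> powr p)" .
  qed (use u2 in auto)
  obtain C0 where C0: "\<And>(k::nat) (l::nat) (f::nat \<Rightarrow> real \<Rightarrow> real). l \<ge> 1 \<Longrightarrow>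
        (\<forall>i\<in>{k+1..k+l}. mono (f i)) \<Longrightarrow>
        (\<forall>i\<in>{k+1..k+l}. integrable M (\<lambda>\<omega>. (f i (X i \<omega>))\<^sup>2)) \<Longrightarrow>
        variance (\<lambda>\<omega>. \<Sum>i\<in>{k+1..k+l}. f i (X i \<omega>))
          \<le> C0 * (\<Sum>i\<in>{k+1..k+l}. variance (\<lambda>\<omega>. f i (X i \<omega>)))"
    using assms(6) unfolding variance_condition_def by blast
  \<comment> \<open>The constant in (V) may be negative as stated; its absolute value is safe
    because variances are nonnegative. Bounded f are square integrable after composition.\<close>
  have var: "variance (\<lambda>\<omega>. \<Sum>i\<in>{s+1..s+n}. f (X i \<omega>)) \<le> \<bar>C0\<bar> * (\<Sum>i\<in>{s+1..s+n}. variance (\<lambda>\<omega>. f (X i \<omega>)))"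
    if n: "n \<ge> 1" and f: "mono f" "\<And>x. \<bar>f x\<bar> \<le> D" for s n :: nat and f and D :: real
  proof -
    have [measurable]: "f \<in> borel_measurable borel"
      using f(1) by (rule borel_measurable_mono)
    have "\<bar>f x\<bar>\<^sup>2 \<le> D\<^sup>2" for x
      using f(2)[of x] by (intro power_mono) auto
    then have "integrable M (\<lambda>\<omega>. (f (X i \<omega>))\<^sup>2)" for i
      by (intro integrable_const_bound[of _ "D\<^sup>2"]) auto
    then have "variance (\<lambda>\<omega>. \<Sum>i\<in>{s+1..s+n}. f (X i \<omega>)) \<le> C0 * (\<Sum>i\<in>{s+1..s+n}. variance (\<lambda>\<omega>. f (X i \<omega>)))"
      using C0[of n s "\<lambda>_. f"] n f(1) by simp
    also have "\<dots> \<le> \<bar>C0\<bar> * (\<Sum>i\<in>{s+1..s+n}. variance (\<lambda>\<omega>. f (X i \<omega>)))"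
      by (intro mult_right_mono sum_nonneg) auto
    finally show ?thesis .
  qed
  define dev where "dev j \<omega> = \<bar>\<Sum>i=1..j. X i \<omega> - expectation (X i)\<bar>" for j :: nat and \<omega>
  have [measurable]: "dev j \<in> borel_measurable M" for j
    unfolding dev_def by measurable
  define P where "P m = prob {\<omega>\<in>space M. \<exists>j\<in>{1..2^m}. dev j \<omega> > \<kappa> * \<epsilon> * b m}" for m :: nat
  have grow_b: "2 ^ k * b l \<le> K * u ^ l * b k" if "k0 \<le> k" "k \<le> l" for k l
    using k0(1)[OF that] b(1) that by simp
  have "summable (\<lambda>m. (u / 2) ^ m * P m)"
    unfolding P_def dev_def
    by (rule dyadic_maximal_summable_signed[OF X var abs_ge_zero b(2,3,4) u2 u\<rho> \<rho>(1) grow_b tail sum])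
      (use \<kappa> \<open>\<epsilon> > 0\<close> in auto)
  then have sumP: "summable (\<lambda>m. (u / 2) ^ Suc m * P (Suc m))"
    by (subst summable_Suc_iff)
  define f where "f n = real n powr (\<alpha> * p - 2) *
      prob {\<omega>\<in>space M. \<exists>j\<in>{1..n}. dev j \<omega> > \<epsilon> * real n powr \<alpha> * Lt (real n powr \<alpha>)}" for n :: nat
  \<comment> \<open>The sign of \<alpha> p - 2 is open. With n = 2^m s and s in [1, 2], the absolute
    value bounds s^(\<alpha> p - 2) in both cases.\<close>
  define c where "c = 2 powr \<bar>\<alpha> * p - 2\<bar>"
  have block: "f n \<le> c * (u / 4) ^ m * P (Suc m)" if m: "m \<ge> k0" and n: "n \<in> {2^m..<2^Suc m}" for m n
  proof -
    have n1: "2 ^ m \<le> real n" "real n \<le> 2 ^ Suc m"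
    proof -
      have "real (2 ^ m) \<le> real n" "real n \<le> real (2 ^ Suc m)"
        using n unfolding of_nat_le_iff by auto
      then show "2 ^ m \<le> real n" "real n \<le> 2 ^ Suc m" by simp_all
    qed
    have pw: "(2 ^ k) powr \<alpha> = a ^ k" for k
      by (simp add: a_def powr_powr mult.commute flip: powr_realpow)
    define x where "x = real n powr \<alpha>"
    have "(2 ^ m) powr \<alpha> \<le> x" "x \<le> (2 ^ Suc m) powr \<alpha>"
      unfolding x_def using n1 \<open>\<alpha> > 0\<close> by (auto intro!: powr_mono2)
    then have x: "a ^ m \<le> x" "x \<le> a ^ Suc m" by (simp_all only: pw)
    \<comment> \<open>As a^m \<le> x \<le> a^(m+1), the point a^(m+1) lies in [x, a x], the range of
      the quasi-monotonicity. Hence every n of the block is compared with the single event at scale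
      m + 1, with threshold \<kappa> \<epsilon> b (m + 1).\<close>
    have "\<kappa> * B (Suc m) \<le> x * Lt x"
      unfolding B_def using x k0(7)[OF m] a1 by (intro x0) auto
    then have le: "\<kappa> * \<epsilon> * b (Suc m) \<le> \<epsilon> * x * Lt x"
      using b(1)[of "Suc m"] m \<open>\<epsilon> > 0\<close> mult_left_mono[of "\<kappa> * B (Suc m)" "x * Lt x" \<epsilon>] by (simp add: mult_ac)
    have prob_le: "prob {\<omega>\<in>space M. \<exists>j\<in>{1..n}. dev j \<omega> > \<epsilon> * x * Lt x} \<le> P (Suc m)"
      unfolding P_def
    proof (rule finite_measure_mono)
      have "{1..n} \<subseteq> {1..2 ^ Suc m}" using n by auto
      then show "{\<omega>\<in>space M. \<exists>j\<in>{1..n}. dev j \<omega> > \<epsilon> * x * Lt x} \<subseteq> {\<omega>\<in>space M. \<exists>j\<in>{1..2 ^ Suc m}. dev j \<omega> > \<kappa> * \<epsilon> * b (Suc m)}"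
        using le by (blast intro: le_less_trans)
    qed measurable
    define s where "s = real n / 2 ^ m"
    have s: "1 \<le> s" "s \<le> 2" using n1 by (simp_all add: s_def field_simps)
    have "real n powr (\<alpha> * p - 2) = (2 ^ m) powr (\<alpha> * p - 2) * s powr (\<alpha> * p - 2)"
      using s by (subst powr_mult[symmetric]) (auto simp: s_def)
    also have "\<dots> \<le> (2 ^ m) powr (\<alpha> * p - 2) * c"
    proof (rule mult_left_mono)
      have "s powr (\<alpha> * p - 2) \<le> s powr \<bar>\<alpha> * p - 2\<bar>"
        using s by (intro powr_mono) auto
      also have "\<dots> \<le> c"
        unfolding c_def using s by (intro powr_mono2) auto
      finally show "s powr (\<alpha> * p - 2) \<le> c" .
    qed simp
    also have "(2 ^ m) powr (\<alpha> * p - 2) = (2 powr (\<alpha> * p - 2)) ^ m"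
      by (simp add: powr_powr mult.commute flip: powr_realpow)
    also have "2 powr (\<alpha> * p - 2) = u / 4"
      by (simp add: u_def powr_diff)
    finally have "real n powr (\<alpha> * p - 2) \<le> c * (u / 4) ^ m" by (simp add: mult.commute)
    with prob_le show ?thesis
      unfolding f_def x_def[symmetric] using u2 by (intro mult_mono) (auto simp: c_def)
  qed
  have f0: "f n \<ge> 0" for n
    by (simp add: f_def)
  have "summable (\<lambda>m. \<Sum>n\<in>{2^m..<2^Suc m}. f n)"
  proof (rule summable_comparison_test_ev)
    show "summable (\<lambda>m. c * 2 / u * ((u / 2) ^ Suc m * P (Suc m)))"
      using sumP by (rule summable_mult)
    show "\<forall>\<^sub>F m in sequentially. norm (\<Sum>n\<in>{2^m..<2^Suc m}. f n) \<le> c * 2 / u * ((u / 2) ^ Suc m * P (Suc m))"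
      using eventually_ge_at_top[of k0]
    proof eventually_elim
      case (elim m)
      have "(\<Sum>n\<in>{2^m..<2^Suc m}. f n) \<le> (\<Sum>n\<in>{(2::nat)^m..<2^Suc m}. c * (u / 4) ^ m * P (Suc m))"
        by (intro sum_mono block elim)
      \<comment> \<open>The block has 2^m terms, which turns the weight (u/4)^m into
        (u/2)^m.\<close>
      also have "\<dots> = c * (2 * (u / 4)) ^ m * P (Suc m)"
        unfolding power_mult_distrib by simp
      also have "\<dots> = c * 2 / u * ((u / 2) ^ Suc m * P (Suc m))"
        using u2 by simp
      finally show ?case
        using f0 by (simp add: sum_nonneg)
    qed
  qed
  from summable_dyadic_blocks[OF f0 this] have "summable (\<lambda>m. f (Suc m))" .
  moreover have "real n powr (\<alpha> * p - 2) * prob {\<omega>\<in>space M.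
      Max ((\<lambda>j. \<bar>\<Sum>i=1..j. (X i \<omega> - expectation (X i))\<bar>) ` {1..n}) > \<epsilon> * real n powr \<alpha> * Lt (real n powr \<alpha>)} = f n"
    if "n \<ge> 1" for n
    using that by (simp add: f_def dev_def Max_gr_iff)
  ultimately show "summable (\<lambda>m. let n = Suc m in real n powr (\<alpha> * p - 2) * prob {\<omega>\<in>space M.
      Max ((\<lambda>j. \<bar>\<Sum>i=1..j. (X i \<omega> - expectation (X i))\<bar>) ` {1..n}) > \<epsilon> * real n powr \<alpha> * Lt (real n powr \<alpha>)})"
    unfolding Let_def by (subst summable_cong[where g = "\<lambda>m. f (Suc m)"]) (auto simp only: intro!: always_eventually)
qed

end
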